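(* Let $n>r\ge 2$ and $1\le t\le 2^r-r-1$ be integers. Suppose that $\mathcal F\subset 2^{[n]}$ is a non-trivial $r$-wise $t$-agreeing family. Then $|\mathcal F|\le (r+t+1)2^{n-r-t}$.
   Context: $[n]=\{1,\ldots,n\}$ and $2^{[n]}$ is its power set. Sets $F_1,\ldots,F_r\subset[n]$ agree on a coordinate $x\in[n]$ if either $x\in\bigcap_{i\in[r]}F_i$ or $x\notin\bigcup_{i\in[r]}F_i$. A family $\mathcal F\subset 2^{[n]}$ is $r$-wise $t$-agreeing if any $r$ sets $F_1,\ldots,F_r\in\mathcal F$ (not necessarily distinct) agree on at least $t$ coordinates. $\mathcal F$ is non-trivial if $\bigcap_{A\in\mathcal F}A=\emptyset$ and $\bigcup_{A\in\mathcal F}A=[n]$. *)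

theory Defs
  imports Main Complex_Main
begin

definition agree_on :: "nat \<Rightarrow> (nat \<Rightarrow> nat set) \<Rightarrow> nat \<Rightarrow> bool" where
  "agree_on r G x \<longleftrightarrow> (\<forall>i<r. x \<in> G i) \<or> (\<forall>i<r. x \<notin> G i)"

definition r_wise_t_agreeing :: "nat \<Rightarrow> nat \<Rightarrow> nat \<Rightarrow> nat set set \<Rightarrow> bool" where
  "r_wise_t_agreeing n r t F \<longleftrightarrow>
     (\<forall>G. (\<forall>i<r. G i \<in> F) \<longrightarrow> card {x \<in> {1..n}. agree_on r G x} \<ge> t)"

definition nontrivial_family :: "nat \<Rightarrow> nat set set \<Rightarrow> bool" where
  "nontrivial_family n F \<longleftrightarrow> \<Inter>F = {} \<and> \<Union>F = {1..n}"

end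

theory Submission
  imports Defs
begin

text \<open>Non-triviality makes an \<open>r\<close>-wise \<open>t\<close>-agreeing family \<open>j\<close>-wise \<open>(t + r - j)\<close>-agreeing for every
  \<open>j \<le> r\<close>. This survives compression, after which the family is shifted and intersecting rather than
  merely agreeing, whereas non-triviality itself might be lost. Sets become words, and shiftedness
  yields Frankl's walk condition: among any \<open>j\<close> members the total number of misses in some prefix
  of length \<open>m\<close> is at most \<open>m - (t + r - j)\<close>.

  Splitting at the first coordinate, the words that hit it fulfil the hypotheses for \<open>t - 1\<close> and those
  that miss it are \<open>r\<close>-wise of level \<open>t + r - 1\<close>, which is exactly the recursion for
  \<open>(r + t + 1) / 2^(r + t)\<close> as long as \<open>t + 2 * r \<le> 2^r\<close>; the case \<open>t = 0\<close> is the case \<open>(r - 1, 1)\<close>.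
  For larger \<open>t\<close>, either all words missing the first coordinate hit the next \<open>t\<close> ones, or some member
  has two early misses, which makes the family \<open>j\<close>-wise of level \<open>t + 2 * (r - j)\<close> and hence smaller.
  For \<open>r \<ge> 4\<close> the same recursion then has room to spare. For \<open>r = 3\<close> it is
  sharpened by a spectral bound: the members with a full prefix form an independent set in a Cayley
  graph whose connection set is any other trace of the family.\<close>

section \<open>Shifting\<close>

definition intersecting :: "nat \<Rightarrow> nat \<Rightarrow> nat \<Rightarrow> nat set set \<Rightarrow> bool" where
  "intersecting n j v F \<longleftrightarrow>
     (\<forall>G. (\<forall>i<j. G i \<in> F) \<longrightarrow> v \<le> card {x \<in> {1..n}. \<forall>i<j. x \<in> G i})"

text \<open>By non-triviality, a coordinate on which the \<open>j\<close> sets agree is spoilt by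
  some member that differs from them there. Adding this member still leaves \<open>v\<close>
  agreements, so the \<open>j\<close> sets must have had one more.\<close>

lemma agreeing_fewer_sets:
  assumes nt: "nontrivial_family n F" and ag: "r_wise_t_agreeing n (Suc j) v F"
    and j: "1 \<le> j" and v: "1 \<le> v"
  shows "r_wise_t_agreeing n j (Suc v) F"
  unfolding r_wise_t_agreeing_def
proof (intro allI impI)
  fix G :: "nat \<Rightarrow> nat set" assume G: "\<forall>i<j. G i \<in> F"
  let ?Z = "{x \<in> {1..n}. agree_on j G x}"
  have ext: "v \<le> card {x \<in> {1..n}. agree_on (Suc j) (G(j := A)) x}" if "A \<in> F" for A
  proof -
    have "\<forall>i<Suc j. (G(j := A)) i \<in> F" using G that by (auto simp: less_Suc_eq)
    with ag show ?thesis unfolding r_wise_t_agreeing_def by blast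
  qed
  have sub: "{x \<in> {1..n}. agree_on (Suc j) (G(j := A)) x} \<subseteq> ?Z" for A
    by (auto simp: agree_on_def less_Suc_eq)
  have "v \<le> card ?Z"
  proof (rule order_trans[OF ext card_mono[OF _ sub]])
    show "G 0 \<in> F" using G j by simp
  qed simp
  with v have "card ?Z \<noteq> 0" by linarith
  then have "?Z \<noteq> {}" by (metis card.empty)
  then obtain x where x: "x \<in> ?Z" by blast
  obtain A where A: "A \<in> F" and dis: "x \<in> A \<longleftrightarrow> x \<notin> G 0"
  proof (cases "x \<in> G 0")
    case True
    have "x \<notin> \<Inter>F" using nt by (simp add: nontrivial_family_def)
    then show ?thesis using that True by auto
  next
    case False
    have "x \<in> \<Union>F" using nt x by (simp add: nontrivial_family_def)
    then show ?thesis using that False by auto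
  qed
  have "{x \<in> {1..n}. agree_on (Suc j) (G(j := A)) x} \<subseteq> ?Z - {x}"
  proof -
    have "\<not> agree_on (Suc j) (G(j := A)) x"
    proof
      assume "agree_on (Suc j) (G(j := A)) x"
      then have "(\<forall>i<Suc j. x \<in> (G(j := A)) i) \<or> (\<forall>i<Suc j. x \<notin> (G(j := A)) i)"
        by (simp add: agree_on_def)
      moreover have "0 < Suc j" "j < Suc j" "(G(j := A)) 0 = G 0" "(G(j := A)) j = A" using j by auto
      ultimately show False using dis by metis
    qed
    then show ?thesis using sub[of A] by blast
  qed
  then have "v \<le> card (?Z - {x})"
    by (rule order_trans[OF ext[OF A] card_mono, rotated]) simp
  also have "\<dots> < card ?Z" using x by (intro card_Diff1_less) auto
  finally show "Suc v \<le> card ?Z" by simp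
qed

lemma nontrivial_agreeing_all_levels:
  assumes nt: "nontrivial_family n F" and ag: "r_wise_t_agreeing n r t F"
    and t: "1 \<le> t" and j: "1 \<le> j" "j \<le> r"
  shows "r_wise_t_agreeing n j (t + r - j) F"
  using j(2,1)
proof (induction j rule: inc_induct)
  case base
  then show ?case using ag by simp
next
  case (step i)
  have "r_wise_t_agreeing n i (Suc (t + r - Suc i)) F"
    using step t by (intro agreeing_fewer_sets[OF nt]) auto
  moreover have "Suc (t + r - Suc i) = t + r - i" using step by simp
  ultimately show ?case by simp
qed

section \<open>Compressions: insertion of a point and left shifts\<close>

definition compress :: "('a \<Rightarrow> 'a) \<Rightarrow> 'a set \<Rightarrow> 'a set" where
  "compress f F = (\<lambda>A. if f A \<in> F then A else f A) ` F"

lemma compressE: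
  assumes "B \<in> compress f F"
  obtains "B \<in> F" "f B \<in> F" | A where "A \<in> F" "f A \<notin> F" "B = f A"
  using assms by (auto simp: compress_def split: if_splits)

text \<open>Members that move land outside \<open>F\<close> and the others stay inside, so two
  values can coincide only if both members moved.\<close>

lemma inj_on_compress:
  assumes "inj_on f {A \<in> F. f A \<noteq> A}"
  shows "inj_on (\<lambda>A. if f A \<in> F then A else f A) F"
  using assms unfolding inj_on_def by (smt (verit, best) mem_Collect_eq)

lemma card_compress:
  assumes "inj_on f {A \<in> F. f A \<noteq> A}"
  shows "card (compress f F) = card F"
  unfolding compress_def by (rule card_image[OF inj_on_compress[OF assms]])

text \<open>Among the families with the invariant \<open>P\<close>, one of maximal total weight is
  stable, since a compression that moves a member strictly increases the weight.\<close>

lemma exists_compressed: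
  fixes s :: "'a \<Rightarrow> nat"
  assumes P0: "P F0" and X: "finite X" "\<And>F. P F \<Longrightarrow> F \<subseteq> X"
    and comp: "\<And>f F. f \<in> \<Phi> \<Longrightarrow> P F \<Longrightarrow> P (compress f F)"
    and inj: "\<And>f. f \<in> \<Phi> \<Longrightarrow> inj_on f {A \<in> X. f A \<noteq> A}"
    and inc: "\<And>f A. f \<in> \<Phi> \<Longrightarrow> A \<in> X \<Longrightarrow> f A \<noteq> A \<Longrightarrow> s A < s (f A)"
  shows "\<exists>F. P F \<and> (\<forall>f\<in>\<Phi>. \<forall>A\<in>F. f A \<in> F)"
proof -
  have "\<forall>F. P F \<longrightarrow> sum s F < Suc (sum s X)"
    using X by (auto simp: less_Suc_eq_le intro!: sum_mono2)
  then obtain F where F: "P F" and mx: "\<And>F'. P F' \<Longrightarrow> sum s F' \<le> sum s F"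
    using ex_has_greatest_nat[of P F0 "sum s" "Suc (sum s X)"] P0 by (metis less_imp_le)
  have "f A \<in> F" if f: "f \<in> \<Phi>" and A: "A \<in> F" for f A
  proof (rule ccontr)
    assume nA: "f A \<notin> F"
    let ?g = "\<lambda>A. if f A \<in> F then A else f A"
    have FX: "F \<subseteq> X" using X F by blast
    have "inj_on f {A \<in> F. f A \<noteq> A}"
      using inj[OF f] FX by (auto simp: inj_on_def)
    then have "sum s (compress f F) = (\<Sum>A\<in>F. s (?g A))"
      unfolding compress_def by (subst sum.reindex[OF inj_on_compress]) auto
    moreover have "sum s F < (\<Sum>A\<in>F. s (?g A))"
    proof (rule sum_strict_mono_ex1)
      show "finite F" using FX X finite_subset by blast
      show "\<forall>B\<in>F. s B \<le> s (?g B)"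
        using inc[OF f] FX by (auto simp: less_imp_le) (metis less_imp_le order_refl subsetD)
      show "\<exists>B\<in>F. s B < s (?g B)"
      proof (rule bexI[OF _ A])
        have "A \<in> X" "f A \<noteq> A" using A nA FX by auto
        then show "s A < s (?g A)" using inc[OF f] nA by simp
      qed
    qed
    ultimately show False using mx[OF comp[OF f F]] by simp
  qed
  with F show ?thesis by blast
qed

text \<open>Members of the compressed family are replaced by members of \<open>F\<close> that differ
  from them at most at \<open>x\<close>. The only danger is an agreement at \<open>x\<close> that
  was not there before; a compressed member avoiding \<open>x\<close> has both of its versions in
  \<open>F\<close>, which leaves the freedom to prevent it.\<close>

lemma agreeing_compress_insert:
  assumes ag: "r_wise_t_agreeing n j v F"
  shows "r_wise_t_agreeing n j v (compress (insert x) F)"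
  unfolding r_wise_t_agreeing_def
proof (intro allI impI)
  fix G :: "nat \<Rightarrow> nat set" assume G: "\<forall>i<j. G i \<in> compress (insert x) F"
  have pre: "\<exists>A\<in>F. A - {x} = G i - {x}" if "i < j" for i
    using G that by (metis compressE Diff_insert_absorb insert_Diff_single Diff_idemp insert_Diff1 singletonI)
  have out: "G i \<in> F" "insert x (G i) \<in> F" if "i < j" "x \<notin> G i" for i
    using G that by (metis compressE insertI1)+
  from pre obtain H where H: "\<And>i. i < j \<Longrightarrow> H i \<in> F" "\<And>i. i < j \<Longrightarrow> H i - {x} = G i - {x}"
    by metis
  have *: "v \<le> card {x \<in> {1..n}. agree_on j H x}" if "\<And>i. i < j \<Longrightarrow> H i \<in> F" for H
    using ag that unfolding r_wise_t_agreeing_def by blast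
  have same: "agree_on j H y \<longleftrightarrow> agree_on j G y"
    if "y \<noteq> x" "\<And>i. i < j \<Longrightarrow> H i - {x} = G i - {x}" for y H
    unfolding agree_on_def using that by (metis DiffD1 DiffI singletonD)
  have fin: "v \<le> card {y \<in> {1..n}. agree_on j G y}"
    if H: "\<And>i. i < j \<Longrightarrow> H i \<in> F" "\<And>i. i < j \<Longrightarrow> H i - {x} = G i - {x}"
      and x: "agree_on j H x \<Longrightarrow> agree_on j G x" for H
  proof -
    have "{y \<in> {1..n}. agree_on j H y} \<subseteq> {y \<in> {1..n}. agree_on j G y}"
    proof (intro subsetI CollectI conjI)
      fix y assume "y \<in> {y \<in> {1..n}. agree_on j H y}"
      then show "y \<in> {1..n}" "agree_on j G y"
        using same[OF _ H(2), of y] x by (cases "y = x", auto)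
    qed
    then have "card {y \<in> {1..n}. agree_on j H y} \<le> card {y \<in> {1..n}. agree_on j G y}"
      by (rule card_mono[rotated]) simp
    with *[OF H(1)] show ?thesis by (rule order_trans)
  qed
  show "v \<le> card {y \<in> {1..n}. agree_on j G y}"
  proof (cases "agree_on j G x")
    case True
    then show ?thesis by (intro fin[of H] H)
  next
    case False
    then obtain a b where ab: "a < j" "x \<notin> G a" "b < j" "x \<in> G b"
      unfolding agree_on_def by blast
    \<comment> \<open>The version of \<open>G a\<close> that differs from \<open>H b\<close> at
      \<open>x\<close> is taken, so that \<open>x\<close> is not counted for
      \<open>?H\<close>.\<close>
    let ?H = "H(a := if x \<in> H b then G a else insert x (G a))"
    have "a \<noteq> b" using ab by auto
    then have "?H b = H b" "x \<in> ?H a \<longleftrightarrow> x \<notin> H b" using ab by auto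
    then have "\<not> agree_on j ?H x"
      unfolding agree_on_def using ab(1,3) by blast
    moreover have "?H i \<in> F" if "i < j" for i
      using H(1)[OF that] out[OF ab(1,2)] by simp
    moreover have "?H i - {x} = G i - {x}" if "i < j" for i
      using H(2)[OF that] ab by auto
    ultimately show ?thesis using fin[of ?H] by blast
  qed
qed

lemma intersecting_compress_insert:
  assumes F: "intersecting n j v F"
  shows "intersecting n j v (compress (insert x) F)"
  unfolding intersecting_def
proof (intro allI impI)
  fix G :: "nat \<Rightarrow> nat set" assume G: "\<forall>i<j. G i \<in> compress (insert x) F"
  have "\<exists>A\<in>F. A \<subseteq> G i" if "i < j" for i
    using G that by (metis compressE subset_insertI order_refl)
  then obtain H where H: "\<And>i. i < j \<Longrightarrow> H i \<in> F" "\<And>i. i < j \<Longrightarrow> H i \<subseteq> G i"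
    by metis
  have "v \<le> card {x \<in> {1..n}. \<forall>i<j. x \<in> H i}" using F H unfolding intersecting_def by blast
  also have "\<dots> \<le> card {x \<in> {1..n}. \<forall>i<j. x \<in> G i}" using H by (intro card_mono) auto
  finally show "v \<le> card {x \<in> {1..n}. \<forall>i<j. x \<in> G i}" .
qed

definition swap_to :: "'a \<Rightarrow> 'a \<Rightarrow> 'a set \<Rightarrow> 'a set" where
  "swap_to x y A = (if x \<notin> A \<and> y \<in> A then insert x (A - {y}) else A)"

text \<open>Moved members are replaced by their originals and unmoved ones by their swaps, which lie
  in \<open>F\<close> as well. Common elements are then compared by sending \<open>y\<close> to
  \<open>x\<close>.\<close>

lemma intersecting_compress_swap:
  assumes F: "intersecting n j v F" and x: "x \<in> {1..n}" and xy: "x \<noteq> y"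
  shows "intersecting n j v (compress (swap_to x y) F)"
  unfolding intersecting_def
proof (intro allI impI)
  fix G :: "nat \<Rightarrow> nat set" assume G: "\<forall>i<j. G i \<in> compress (swap_to x y) F"
  let ?I = "\<lambda>G. {z \<in> {1..n}. \<forall>i<j. z \<in> G i}"
  show "v \<le> card (?I G)"
  proof (cases "\<forall>i<j. G i \<in> F")
    case True
    then show ?thesis using F by (simp add: intersecting_def)
  next
    case False
    then obtain a where a: "a < j" "G a \<notin> F" by blast
    have "\<exists>A\<in>F. (G i \<in> F \<and> A = swap_to x y (G i)) \<or>
        (G i \<notin> F \<and> x \<notin> A \<and> y \<in> A \<and> G i = insert x (A - {y}))" if "i < j" for i
    proof -
      from G that have "G i \<in> compress (swap_to x y) F" by blast
      then show ?thesis
        by (cases rule: compressE) (auto simp: swap_to_def split: if_splits)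
    qed
    then obtain H where H: "\<And>i. i < j \<Longrightarrow> H i \<in> F"
      "\<And>i. i < j \<Longrightarrow> (G i \<in> F \<and> H i = swap_to x y (G i)) \<or>
        (G i \<notin> F \<and> x \<notin> H i \<and> y \<in> H i \<and> G i = insert x (H i - {y}))"
      by metis
    \<comment> \<open>The original of the moved member \<open>G a\<close> lacks \<open>x\<close>, so
      \<open>x\<close> is free to receive \<open>y\<close>.\<close>
    have xH: "x \<notin> ?I H" using H(2)[OF a(1)] a by blast
    have other: "z \<in> H i \<longleftrightarrow> z \<in> G i" if "i < j" "z \<noteq> x" "z \<noteq> y" for z i
    proof -
      have "z \<in> swap_to x y A \<longleftrightarrow> z \<in> A" "z \<in> insert x (A - {y}) \<longleftrightarrow> z \<in> A" for A
        using that by (auto simp: swap_to_def)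
      with H(2)[OF that(1)] show ?thesis by metis
    qed
    have yx: "x \<in> ?I G" if "y \<in> ?I H"
    proof -
      have "x \<in> G i" if i: "i < j" for i
      proof -
        have "y \<in> H i" using \<open>y \<in> ?I H\<close> i by blast
        moreover have "x \<in> A" if "y \<in> swap_to x y A" for A
          using that xy by (auto simp: swap_to_def split: if_splits)
        ultimately show ?thesis using H(2)[OF i] by (metis insertI1)
      qed
      with x show ?thesis by blast
    qed
    let ?f = "\<lambda>z. if z = y then x else z"
    have "inj_on ?f (?I H)" using xH by (auto simp: inj_on_def)
    moreover have "?f ` ?I H \<subseteq> ?I G"
    proof
      fix w assume "w \<in> ?f ` ?I H"
      then obtain z where z: "z \<in> ?I H" "w = ?f z" by blast
      show "w \<in> ?I G"
      proof (cases "z = y")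
        case True
        then show ?thesis using z yx by simp
      next
        case False
        moreover have "z \<noteq> x" using z xH by blast
        ultimately show ?thesis using z other by auto
      qed
    qed
    ultimately have "card (?I H) \<le> card (?I G)" by (rule card_inj_on_le) simp
    moreover have "v \<le> card (?I H)" using F H unfolding intersecting_def by blast
    ultimately show ?thesis by simp
  qed
qed

lemma up_closed_superset:
  assumes up: "\<And>x A. x \<in> {1..n} \<Longrightarrow> A \<in> F \<Longrightarrow> insert x A \<in> F"
    and A: "A \<in> F" "A \<subseteq> B" "B \<subseteq> {1..n::nat}"
  shows "B \<in> F"
proof -
  have "A \<union> C \<in> F" if "finite C" "C \<subseteq> {1..n}" for C
    using that A up by (induction C rule: finite_induct) auto
  from this[of B] A finite_subset[of B "{1..n}"] show ?thesis by (simp add: Un_absorb1)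
qed

text \<open>Up-closure permits enlarging \<open>G 0\<close> by all points that lie in none of the
  sets. Afterwards no coordinate is missed by all sets, and no common element has been created
  because there is a second set.\<close>

lemma agreeing_up_closed_imp_intersecting:
  assumes up: "\<And>x A. x \<in> {1..n} \<Longrightarrow> A \<in> F \<Longrightarrow> insert x A \<in> F"
    and sub: "F \<subseteq> Pow {1..n}"
    and ag: "r_wise_t_agreeing n j v F" and j: "2 \<le> j"
  shows "intersecting n j v F"
  unfolding intersecting_def
proof (intro allI impI)
  fix G :: "nat \<Rightarrow> nat set" assume G: "\<forall>i<j. G i \<in> F"
  define A where "A = G 0 \<union> ({1..n} - (\<Union>i<j. G i))"
  have 0: "0 < j" "1 < j" using j by auto
  have "G 0 \<in> F" using G 0 by blast
  have "G 0 \<subseteq> A" "A \<subseteq> {1..n}" using \<open>G 0 \<in> F\<close> sub by (auto simp: A_def)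
  then have "A \<in> F" using up_closed_superset[of n F "G 0" A] up \<open>G 0 \<in> F\<close> by blast
  then have "\<forall>i<j. (G(0 := A)) i \<in> F" using G by simp
  then have "v \<le> card {x \<in> {1..n}. agree_on j (G(0 := A)) x}"
    using ag unfolding r_wise_t_agreeing_def by blast
  moreover have "{x \<in> {1..n}. agree_on j (G(0 := A)) x} \<subseteq> {x \<in> {1..n}. \<forall>i<j. x \<in> G i}"
  proof
    fix x assume "x \<in> {x \<in> {1..n}. agree_on j (G(0 := A)) x}"
    then have x: "x \<in> {1..n}" and "agree_on j (G(0 := A)) x" by auto
    then consider "\<forall>i<j. x \<in> (G(0 := A)) i" | "\<forall>i<j. x \<notin> (G(0 := A)) i"
      unfolding agree_on_def by blast
    then have "\<forall>i<j. x \<in> G i"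
    proof cases
      case 1
      then have A': "x \<in> A" and G': "x \<in> G i" if "i < j" "i \<noteq> 0" for i
        using 0(1) that by (metis fun_upd_apply)+
      then have "x \<in> G 0" using 0(2) by (force simp: A_def)
      with G' show ?thesis by metis
    next
      case 2
      then have "x \<notin> A" and G': "x \<notin> G i" if "i < j" "i \<noteq> 0" for i
        using 0(1) that by (metis fun_upd_apply)+
      then have "x \<notin> A" using 0(2) by (metis zero_neq_one)
      then have "x \<notin> G 0" "x \<in> (\<Union>i<j. G i)" using x by (auto simp: A_def)
      with G' have False by (metis UN_E lessThan_iff)
      then show ?thesis ..
    qed
    with x show "x \<in> {x \<in> {1..n}. \<forall>i<j. x \<in> G i}" by blast
  qed
  then have "card {x \<in> {1..n}. agree_on j (G(0 := A)) x} \<le> card {x \<in> {1..n}. \<forall>i<j. x \<in> G i}"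
    by (rule card_mono[rotated]) simp
  ultimately show "v \<le> card {x \<in> {1..n}. \<forall>i<j. x \<in> G i}" by linarith
qed


lemma exists_shifted_intersecting_family:
  assumes nt: "nontrivial_family n F" and ag: "r_wise_t_agreeing n r t F"
    and sub: "F \<subseteq> Pow {1..n}" and t: "1 \<le> t"
  obtains F' where "F' \<subseteq> Pow {1..n}" "card F' = card F"
    "\<And>j. 2 \<le> j \<Longrightarrow> j \<le> r \<Longrightarrow> intersecting n j (t + r - j) F'"
    "\<And>x A. x \<in> {1..n} \<Longrightarrow> A \<in> F' \<Longrightarrow> insert x A \<in> F'"
    "\<And>x y A. x \<in> {1..n} \<Longrightarrow> y \<in> {1..n} \<Longrightarrow> x < y \<Longrightarrow> A \<in> F' \<Longrightarrow> swap_to x y A \<in> F'"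
proof -
  let ?X = "Pow {1..n}"
  \<comment> \<open>The weights are positive and decrease along the coordinates, so insertions and
    left shifts both increase the total.\<close>
  define s where "s = (\<lambda>A. \<Sum>x\<in>A. Suc n - x)"
  have s_insert: "s A < s (insert x A)" if "x \<in> {1..n}" "A \<in> ?X" "insert x A \<noteq> A" for x A
  proof -
    have "finite A" "x \<notin> A" using that finite_subset[of A "{1..n}"] by auto
    then have "s (insert x A) = (Suc n - x) + s A" by (simp add: s_def)
    moreover have "0 < Suc n - x" using that by simp
    ultimately show ?thesis by linarith
  qed
  have s_swap: "s A < s (swap_to x y A)"
    if "x \<in> {1..n}" "y \<in> {1..n}" "x < y" "A \<in> ?X" "swap_to x y A \<noteq> A" for x y A
  proof -
    have "finite A" "x \<notin> A" "y \<in> A"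
      using that finite_subset[of A "{1..n}"] by (auto simp: swap_to_def split: if_splits)
    then have "s A = (Suc n - y) + s (A - {y})" "s (swap_to x y A) = (Suc n - x) + s (A - {y})"
      by (simp_all add: s_def swap_to_def sum.remove)
    moreover have "Suc n - y < Suc n - x" using that by auto
    ultimately show ?thesis by linarith
  qed
  have inj_insert: "inj_on (insert x) {A \<in> X. insert x A \<noteq> A}" for x :: nat and X
    by (auto simp: inj_on_def)
  have inj_swap: "inj_on (swap_to x y) {A \<in> X. swap_to x y A \<noteq> A}" for x y :: nat and X
    by (rule inj_on_inverseI[where g = "\<lambda>B. insert y (B - {x})"])
      (auto simp: swap_to_def split: if_splits)
  have compress_sub: "compress f G \<subseteq> ?X" if "G \<subseteq> ?X" "\<And>A. A \<in> ?X \<Longrightarrow> f A \<in> ?X" for f G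
    using that unfolding compress_def by (smt (verit, best) image_subsetI subsetD)
  have swap_sub: "swap_to x y A \<in> ?X" if "x \<in> {1..n}" "A \<in> ?X" for x y A
    using that by (auto simp: swap_to_def)
  \<comment> \<open>First pass, with insertions only: the invariant records the agreement levels
    that non-triviality provides instead of non-triviality itself.\<close>
  define P where "P = (\<lambda>G. G \<subseteq> ?X \<and> card G = card F \<and>
      (\<forall>j. 1 \<le> j \<longrightarrow> j \<le> r \<longrightarrow> r_wise_t_agreeing n j (t + r - j) G))"
  have PF: "P F"
    using sub nontrivial_agreeing_all_levels[OF nt ag t] by (simp add: P_def)
  have P_step: "P (compress f G)" if f: "f \<in> insert ` {1..n}" and PG: "P G" for f G
  proof -
    obtain x where x: "x \<in> {1..n}" "f = insert x" using f by blast
    have G: "G \<subseteq> ?X" "card G = card F" using PG by (auto simp: P_def)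
    have "compress f G \<subseteq> ?X" using compress_sub[OF G(1)] x by auto
    moreover have "card (compress f G) = card F"
      using card_compress[of f G] inj_insert x G by simp
    ultimately show ?thesis
      using PG x agreeing_compress_insert by (simp add: P_def)
  qed
  have inj: "inj_on f {A \<in> ?X. f A \<noteq> A}" if "f \<in> insert ` {1..n}" for f
    using that inj_insert by blast
  have inc: "s A < s (f A)" if "f \<in> insert ` {1..n}" "A \<in> ?X" "f A \<noteq> A" for f A
    using that s_insert by blast
  have fin: "finite ?X" and PX: "\<And>G. P G \<Longrightarrow> G \<subseteq> ?X" by (auto simp: P_def)
  have "\<exists>G. P G \<and> (\<forall>f\<in>insert ` {1..n}. \<forall>A\<in>G. f A \<in> G)"
    by (rule exists_compressed[where P = P and ?F0.0 = F and X = ?X and s = s])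
      (fact PF fin PX P_step inj inc)+
  then obtain G where G: "P G" "\<And>f A. f \<in> insert ` {1..n} \<Longrightarrow> A \<in> G \<Longrightarrow> f A \<in> G"
    by auto
  \<comment> \<open>Second pass: for the up-closed family agreement has become intersection, which
    both kinds of compression preserve.\<close>
  define \<Phi> where "\<Phi> = insert ` {1..n} \<union> {swap_to x y |x y. x \<in> {1..n} \<and> y \<in> {1..n} \<and> x < y}"
  define Q where "Q = (\<lambda>G. G \<subseteq> ?X \<and> card G = card F \<and>
      (\<forall>j. 2 \<le> j \<longrightarrow> j \<le> r \<longrightarrow> intersecting n j (t + r - j) G))"
  have "intersecting n j (t + r - j) G" if "2 \<le> j" "j \<le> r" for j
    by (rule agreeing_up_closed_imp_intersecting) (use G that in \<open>auto simp: P_def\<close>)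
  then have QG: "Q G" using G by (simp add: P_def Q_def)
  have Q_step: "Q (compress f G)" if f: "f \<in> \<Phi>" and QG: "Q G" for f G
  proof -
    have G: "G \<subseteq> ?X" "card G = card F" using QG by (auto simp: Q_def)
    consider x where "x \<in> {1..n}" "f = insert x" |
      x y where "x \<in> {1..n}" "y \<in> {1..n}" "x < y" "f = swap_to x y"
      using f by (auto simp: \<Phi>_def)
    then show ?thesis
    proof cases
      case (1 x)
      have "compress f G \<subseteq> ?X" using compress_sub[OF G(1)] 1 by auto
      moreover have "card (compress f G) = card F"
        using card_compress[of f G] inj_insert 1 G by simp
      ultimately show ?thesis
        using QG 1 intersecting_compress_insert by (simp add: Q_def)
    next
      case (2 x y)
      have "compress f G \<subseteq> ?X" using compress_sub[OF G(1)] swap_sub 2 by blast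
      moreover have "card (compress f G) = card F"
        using card_compress[of f G] inj_swap 2 G by simp
      ultimately show ?thesis
        using QG 2 intersecting_compress_swap by (simp add: Q_def)
    qed
  qed
  have inj': "inj_on f {A \<in> ?X. f A \<noteq> A}" if "f \<in> \<Phi>" for f
    using that inj_insert inj_swap unfolding \<Phi>_def by blast
  have inc': "s A < s (f A)" if "f \<in> \<Phi>" "A \<in> ?X" "f A \<noteq> A" for f A
    using that s_insert s_swap unfolding \<Phi>_def by blast
  have QX: "\<And>G. Q G \<Longrightarrow> G \<subseteq> ?X" by (auto simp: Q_def)
  have "\<exists>F'. Q F' \<and> (\<forall>f\<in>\<Phi>. \<forall>A\<in>F'. f A \<in> F')"
    by (rule exists_compressed[where P = Q and ?F0.0 = G and X = ?X and s = s])
      (fact QG fin QX Q_step inj' inc')+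
  then obtain F' where F': "Q F'" "\<And>f A. f \<in> \<Phi> \<Longrightarrow> A \<in> F' \<Longrightarrow> f A \<in> F'"
    by auto
  show thesis
  proof (rule that[of F'])
    show "swap_to x y A \<in> F'" if "x \<in> {1..n}" "y \<in> {1..n}" "x < y" "A \<in> F'" for x y A
      using F'(2)[of "swap_to x y" A] that unfolding \<Phi>_def by blast
    show "insert x A \<in> F'" if "x \<in> {1..n}" "A \<in> F'" for x A
      using F'(2)[of "insert x" A] that unfolding \<Phi>_def by blast
  qed (use F' in \<open>auto simp: Q_def\<close>)
qed

text \<open>Swaps that exchange an element of \<open>A - B\<close> for an earlier one of
  \<open>B - A\<close> turn \<open>A\<close> into a subset of \<open>B\<close>; up-closure does the
  rest.\<close>

lemma shifted_closed_under_dominance: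
  fixes n :: nat
  assumes up: "\<And>x A. x \<in> {1..n} \<Longrightarrow> A \<in> F \<Longrightarrow> insert x A \<in> F"
    and sw: "\<And>x y A. x \<in> {1..n} \<Longrightarrow> y \<in> {1..n} \<Longrightarrow> x < y \<Longrightarrow> A \<in> F \<Longrightarrow> swap_to x y A \<in> F"
    and A: "A \<in> F" "A \<subseteq> {1..n}" and B: "B \<subseteq> {1..n}"
    and dom: "\<And>m. m \<le> n \<Longrightarrow> card ({1..m} - B) \<le> card ({1..m} - A)"
  shows "B \<in> F"
  using A dom
proof (induction "card (A - B)" arbitrary: A)
  case 0
  then have "finite (A - B)" by (meson finite_Diff finite_atLeastAtMost finite_subset)
  with 0 have "A \<subseteq> B" by auto
  then show ?case using up_closed_superset[of n F A B] up 0 B by blast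
next
  case (Suc k)
  define y where "y = (LEAST y. y \<in> A - B)"
  have "A - B \<noteq> {}" using Suc(2) by force
  then have y: "y \<in> A - B" unfolding y_def by (metis LeastI ex_in_conv)
  have le_y: "z \<notin> A" if "z < y" "z \<notin> B" for z
    using that not_less_Least[of z "\<lambda>y. y \<in> A - B"] by (auto simp: y_def)
  have yn: "y \<in> {1..n}" using y Suc by auto
  \<comment> \<open>Below \<open>y\<close>, whatever \<open>B\<close> misses is missed by
    \<open>A\<close> too, and \<open>y\<close> itself is missed by \<open>B\<close> alone. If
    \<open>A\<close> contained all of \<open>B\<close> below \<open>y\<close>, it would miss
    strictly fewer points of \<open>{1..y}\<close>.\<close>
  obtain p where p: "p \<in> B" "p \<notin> A" "p < y"
  proof (rule ccontr)
    assume "\<not> thesis"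
    then have "{1..y} - A \<subseteq> {1..y} - B" using that y by force
    moreover have "y \<in> {1..y} - B" "y \<notin> {1..y} - A" using y yn by auto
    ultimately have "{1..y} - A \<subset> {1..y} - B" by blast
    then have "card ({1..y} - A) < card ({1..y} - B)" by (intro psubset_card_mono) auto
    with Suc(5)[of y] yn show False by simp
  qed
  let ?A = "insert p (A - {y})"
  have pn: "p \<in> {1..n}" using p B by auto
  have "swap_to p y A = ?A" using p y by (simp add: swap_to_def)
  then have "?A \<in> F" using sw[OF pn yn p(3) Suc(3)] by simp
  moreover have "k = card (?A - B)"
  proof -
    have "?A - B = (A - B) - {y}" using p by auto
    then show ?thesis using Suc(2) y by simp
  qed
  moreover have "?A \<subseteq> {1..n}" using Suc pn by auto
  \<comment> \<open>Before \<open>y\<close> dominance holds by inclusion; from \<open>y\<close> on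
    the exchange leaves the number of misses unchanged.\<close>
  moreover have "card ({1..m} - B) \<le> card ({1..m} - ?A)" if m: "m \<le> n" for m
  proof (cases "m < y")
    case True
    then have "{1..m} - B \<subseteq> {1..m} - ?A" using le_y p by auto
    then show ?thesis by (intro card_mono) auto
  next
    case False
    then have "{1..m} - ?A = insert y ({1..m} - A - {p})" using p y yn by auto
    moreover have "p \<in> {1..m} - A" using False p pn by auto
    ultimately have "card ({1..m} - ?A) = Suc (card ({1..m} - A - {p}))"
      and "card ({1..m} - A) = Suc (card ({1..m} - A - {p}))"
      using y by (simp, metis card.remove finite_Diff finite_atLeastAtMost)
    then show ?thesis using Suc(5)[OF m] by simp
  qed
  ultimately show ?case using Suc(1) by blast
qed

text \<open>Frankl's walk condition. If it failed, each coordinate from \<open>v\<close> on could be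
  assigned to one of the \<open>j\<close> sets in such a way that the sets missing just their
  assigned coordinates still belong to \<open>F\<close>, although their common elements all lie
  below \<open>v\<close>.\<close>

lemma dominance_closed_intersecting:
  assumes dom: "\<And>A B. A \<in> F \<Longrightarrow> B \<subseteq> {1..n} \<Longrightarrow>
      (\<And>m. m \<le> n \<Longrightarrow> card ({1..m} - B) \<le> card ({1..m} - A)) \<Longrightarrow> B \<in> F"
    and int: "intersecting n j v F" and G: "\<And>i. i < j \<Longrightarrow> G i \<in> F"
  shows "\<exists>m\<le>n. (\<Sum>i<j. card ({1..m} - G i)) + v \<le> m"
proof (rule ccontr)
  assume "\<not> ?thesis"
  then have low: "m < (\<Sum>i<j. card ({1..m} - G i)) + v" if "m \<le> n" for m
    using that by (metis not_le)
  have v: "1 \<le> v" using low[of 0] by simp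
  have "\<exists>own. (\<forall>q\<in>{v..p}. own q < j) \<and>
      (\<forall>i<j. \<forall>m\<le>p. card {q \<in> {v..m}. own q = i} \<le> card ({1..m} - G i))" if "p \<le> n" for p
    using that
  proof (induction p)
    case 0
    then show ?case using v by auto
  next
    case (Suc p)
    then obtain own where own: "\<forall>q\<in>{v..p}. own q < j"
      "\<And>i m. i < j \<Longrightarrow> m \<le> p \<Longrightarrow> card {q \<in> {v..m}. own q = i} \<le> card ({1..m} - G i)"
      by auto
    show ?case
    proof (cases "v \<le> Suc p")
      case False
      then have "{q \<in> {v..m}. own q = i} = {}" if "m \<le> Suc p" for m i using that by auto
      then show ?thesis using False by (intro exI[of _ own]) auto
    next
      case True
      \<comment> \<open>The assignment is greedy: the sets have more misses among the first
        \<open>Suc p\<close> coordinates than there are assigned coordinates from \<open>v\<close>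
        to \<open>p\<close>, so some set has one to spare.\<close>
      have "\<exists>i<j. card {q \<in> {v..p}. own q = i} < card ({1..Suc p} - G i)"
      proof (rule ccontr)
        assume "\<not> ?thesis"
        then have "(\<Sum>i<j. card ({1..Suc p} - G i)) \<le> (\<Sum>i<j. card {q \<in> {v..p}. own q = i})"
          by (intro sum_mono) (metis lessThan_iff not_le)
        also have "\<dots> = card (\<Union>i<j. {q \<in> {v..p}. own q = i})"
          by (rule card_UN_disjoint[symmetric]) auto
        also have "(\<Union>i<j. {q \<in> {v..p}. own q = i}) = {v..p}" using own by auto
        finally show False using low[OF Suc(2)] True by simp
      qed
      then obtain a where a: "a < j" "card {q \<in> {v..p}. own q = a} < card ({1..Suc p} - G a)"
        by blast
      let ?own = "own(Suc p := a)"
      have "card {q \<in> {v..m}. ?own q = i} \<le> card ({1..m} - G i)" if i: "i < j" and m: "m \<le> Suc p" for i m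
      proof (cases "m = Suc p")
        case False
        then have "{q \<in> {v..m}. ?own q = i} = {q \<in> {v..m}. own q = i}" using m by auto
        then show ?thesis using own(2)[OF i, of m] m False by simp
      next
        case m: True
        show ?thesis
        proof (cases "i = a")
          case True
          then have "{q \<in> {v..m}. ?own q = i} \<subseteq> insert (Suc p) {q \<in> {v..p}. own q = a}"
            using m by auto
          then have "card {q \<in> {v..m}. ?own q = i} \<le> Suc (card {q \<in> {v..p}. own q = a})"
            using card_mono[of "insert (Suc p) {q \<in> {v..p}. own q = a}"] card_insert_le_m1
            by (fastforce simp: card_insert_if split: if_splits)
          then show ?thesis using a True m by simp
        next
          case False
          then have "{q \<in> {v..m}. ?own q = i} \<subseteq> {q \<in> {v..p}. own q = i}"
            using m by (auto simp: le_Suc_eq)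
          then have "card {q \<in> {v..m}. ?own q = i} \<le> card {q \<in> {v..p}. own q = i}"
            by (intro card_mono) auto
          also have "\<dots> \<le> card ({1..p} - G i)" using own(2)[OF i] by blast
          also have "\<dots> \<le> card ({1..m} - G i)" using m by (intro card_mono) auto
          finally show ?thesis .
        qed
      qed
      moreover have "\<forall>q\<in>{v..Suc p}. ?own q < j" using own(1) a by (auto simp: le_Suc_eq)
      ultimately show ?thesis by blast
    qed
  qed
  from this[of n] obtain own where own: "\<forall>q\<in>{v..n}. own q < j"
    "\<And>i m. i < j \<Longrightarrow> m \<le> n \<Longrightarrow> card {q \<in> {v..m}. own q = i} \<le> card ({1..m} - G i)"
    by blast
  define B where "B = (\<lambda>i. {1..n} - {q \<in> {v..n}. own q = i})"
  have "B i \<in> F" if "i < j" for i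
  proof (rule dom[OF G[OF that]])
    show "B i \<subseteq> {1..n}" by (auto simp: B_def)
    fix m assume m: "m \<le> n"
    have "{1..m} - B i = {q \<in> {v..m}. own q = i}" using m v by (auto simp: B_def)
    then show "card ({1..m} - B i) \<le> card ({1..m} - G i)" using own(2)[OF that m] by simp
  qed
  then have "v \<le> card {x \<in> {1..n}. \<forall>i<j. x \<in> B i}" using int unfolding intersecting_def by blast
  also have "{x \<in> {1..n}. \<forall>i<j. x \<in> B i} \<subseteq> {1..<v}" using own(1) by (force simp: B_def)
  then have "card {x \<in> {1..n}. \<forall>i<j. x \<in> B i} \<le> card {1..<v}" by (intro card_mono) auto
  finally show False using v by simp
qed

section \<open>Words and the walk condition\<close>

definition cube :: "nat \<Rightarrow> bool list set" where
  "cube n = {xs. length xs = n}"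

definition misses :: "nat \<Rightarrow> bool list \<Rightarrow> nat" where
  "misses m xs = length (filter Not (take m xs))"

definition trace :: "bool list \<Rightarrow> bool list set \<Rightarrow> bool list set" where
  "trace p L = {xs. p @ xs \<in> L}"

definition dens :: "nat \<Rightarrow> bool list set \<Rightarrow> real" where
  "dens n L = real (card L) / 2 ^ n"

text \<open>For a shifted family this is equivalent to being \<open>r\<close>-wise \<open>t\<close>-intersecting, but it is
  inherited by the traces at the first coordinate without any further use of shifting.\<close>

definition good :: "nat \<Rightarrow> nat \<Rightarrow> nat \<Rightarrow> bool list set \<Rightarrow> bool" where
  "good n r t L \<longleftrightarrow> (\<forall>As. length As = r \<longrightarrow> set As \<subseteq> L \<longrightarrow>
     (\<exists>m\<le>n. (\<Sum>A\<leftarrow>As. misses m A) + t \<le> m))"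

lemma cube_0 [simp]: "cube 0 = {[]}"
  by (auto simp: cube_def)

lemma cube_Suc: "cube (Suc n) = (#) True ` cube n \<union> (#) False ` cube n"
  by (force simp: cube_def length_Suc_conv image_iff)

lemma finite_cube [simp]: "finite (cube n)"
  by (induction n) (auto simp: cube_Suc)

lemma sum_cube_Suc:
  fixes f :: "bool list \<Rightarrow> 'a::comm_monoid_add"
  shows "(\<Sum>x\<in>cube (Suc n). f x) = (\<Sum>x\<in>cube n. f (True # x) + f (False # x))"
  unfolding cube_Suc
  by (subst sum.union_disjoint) (auto simp: sum.reindex sum.distrib)

lemma card_cube: "card (cube n) = 2 ^ n"
proof (induction n)
  case (Suc n)
  have "card (cube (Suc n)) = (\<Sum>x\<in>cube n. 1 + 1)"
    unfolding card_eq_sum by (rule sum_cube_Suc)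
  with Suc show ?case by simp
qed simp

lemma misses_0 [simp]: "misses 0 xs = 0"
  by (simp add: misses_def)

lemma misses_Nil [simp]: "misses m [] = 0"
  by (simp add: misses_def)

lemma misses_Cons [simp]: "misses (Suc m) (b # xs) = (if b then 0 else 1) + misses m xs"
  by (simp add: misses_def)

lemma misses_append: "misses (length p + m) (p @ xs) = misses (length p) p + misses m xs"
  by (simp add: misses_def)

lemma misses_append_le: "m \<le> length p \<Longrightarrow> misses m (p @ xs) = misses m p"
  by (simp add: misses_def)

lemma misses_mono: "m \<le> m' \<Longrightarrow> misses m xs \<le> misses m' xs"
proof (induction m arbitrary: m' xs)
  case (Suc m)
  then obtain k where "m' = Suc k" by (metis Suc_le_D)
  with Suc show ?case by (cases xs) auto
qed simp

lemma trace_Nil [simp]: "trace [] L = L"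
  by (simp add: trace_def)

lemma trace_trace: "trace q (trace p L) = trace (p @ q) L"
  by (simp add: trace_def)

lemma trace_cube: "L \<subseteq> cube (length p + n) \<Longrightarrow> trace p L \<subseteq> cube n"
  by (auto simp: trace_def cube_def)

lemma trace_cube_Suc: "L \<subseteq> cube (Suc n) \<Longrightarrow> trace [b] L \<subseteq> cube n"
  by (auto simp: trace_def cube_def)

lemma dens_nonneg [simp]: "0 \<le> dens n L"
  by (simp add: dens_def)

lemma dens_empty [simp]: "dens n {} = 0"
  by (simp add: dens_def)

lemma dens_mono: "L \<subseteq> L' \<Longrightarrow> L' \<subseteq> cube n \<Longrightarrow> dens n L \<le> dens n L'"
  unfolding dens_def
  by (intro divide_right_mono) (auto intro!: card_mono intro: finite_subset[OF _ finite_cube])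

lemma dens_cube [simp]: "dens n (cube n) = 1"
  by (simp add: dens_def card_cube)

lemma dens_le_1: "L \<subseteq> cube n \<Longrightarrow> dens n L \<le> 1"
  using dens_mono[of L "cube n" n] by simp

lemma dens_Suc:
  assumes "L \<subseteq> cube (Suc n)"
  shows "dens (Suc n) L = (dens n (trace [True] L) + dens n (trace [False] L)) / 2"
proof -
  have fin: "finite (trace [b] L)" for b
    using finite_subset[OF trace_cube_Suc[OF assms]] by simp
  have "L = (#) True ` trace [True] L \<union> (#) False ` trace [False] L"
    using assms by (force simp: trace_def cube_Suc)
  then have "card L = card ((#) True ` trace [True] L \<union> (#) False ` trace [False] L)" by simp
  also have "\<dots> = card (trace [True] L) + card (trace [False] L)"
    using fin by (subst card_Un_disjoint) (auto simp: card_image)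
  finally show ?thesis by (simp add: dens_def field_simps)
qed

lemma dens_prefix_sum:
  assumes "L \<subseteq> cube (k + n)"
  shows "2 ^ k * dens (k + n) L = (\<Sum>p\<in>cube k. dens n (trace p L))"
  using assms
proof (induction k arbitrary: L)
  case (Suc k)
  then have L: "L \<subseteq> cube (Suc (k + n))" by simp
  have "2 ^ Suc k * dens (Suc k + n) L
      = 2 ^ k * dens (k + n) (trace [True] L) + 2 ^ k * dens (k + n) (trace [False] L)"
    using dens_Suc[OF L] by (simp add: algebra_simps) (simp add: distrib_left[symmetric])
  then show ?case
    using Suc.IH[OF trace_cube_Suc[OF L]] by (simp add: sum_cube_Suc trace_trace sum.distrib)
qed simp

lemma good_mono:
  assumes "good n r t L" "t' \<le> t"
  shows "good n r t' L"
  unfolding good_def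
proof (intro allI impI)
  fix As :: "bool list list" assume "length As = r" "set As \<subseteq> L"
  then obtain m where "m \<le> n" "(\<Sum>A\<leftarrow>As. misses m A) + t \<le> m"
    using assms(1) unfolding good_def by blast
  with assms(2) show "\<exists>m\<le>n. (\<Sum>A\<leftarrow>As. misses m A) + t' \<le> m" by (intro exI[of _ m]) linarith
qed

text \<open>When \<open>p\<close> is put in front of all \<open>r\<close> words, its misses count
  \<open>r\<close> times. The hypothesis \<open>early\<close> keeps the witness \<open>m\<close>
  from lying inside \<open>p\<close>, so it restricts to the remaining coordinates.\<close>

lemma good_trace:
  assumes L: "good (length p + n) r t L"
    and early: "\<And>m. m < length p \<Longrightarrow> m < r * misses m p + t"
    and t': "t' + length p \<le> r * misses (length p) p + t"
  shows "good n r t' (trace p L)"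
  unfolding good_def
proof (intro allI impI)
  fix As :: "bool list list" assume As: "length As = r" "set As \<subseteq> trace p L"
  then have "length (map ((@) p) As) = r" "set (map ((@) p) As) \<subseteq> L" by (auto simp: trace_def)
  with L obtain m where m: "m \<le> length p + n"
    "(\<Sum>A\<leftarrow>map ((@) p) As. misses m A) + t \<le> m"
    unfolding good_def by blast
  have "\<not> m < length p"
  proof
    assume "m < length p"
    then have "(\<Sum>A\<leftarrow>map ((@) p) As. misses m A) = r * misses m p"
      using As by (simp add: o_def misses_append_le sum_list_triv)
    with early[OF \<open>m < length p\<close>] m show False by simp
  qed
  then obtain k where k: "m = length p + k" by (metis le_Suc_ex not_le)
  have "(\<Sum>A\<leftarrow>map ((@) p) As. misses m A) = r * misses (length p) p + (\<Sum>A\<leftarrow>As. misses k A)"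
    using As by (simp add: o_def k misses_append sum_list_addf sum_list_triv)
  with m k t' show "\<exists>m\<le>n. (\<Sum>A\<leftarrow>As. misses m A) + t' \<le> m" by (intro exI[of _ k]) simp
qed

lemma good_trace_True:
  assumes "good (Suc n) r t L" "1 \<le> t"
  shows "good n r (t - 1) (trace [True] L)"
  using assms by (intro good_trace[of "[True]" n r t]) auto

text \<open>The common miss counts \<open>r\<close> times while one coordinate is used up, whence
  the gain of \<open>r - 1\<close>.\<close>

lemma good_trace_False:
  assumes "good (Suc n) r t L" "1 \<le> t"
  shows "good n r (t + r - 1) (trace [False] L)"
  using assms by (intro good_trace[of "[False]" n r t]) auto

lemma good_nonempty:
  assumes "good n r t L" "L \<noteq> {}"
  shows "t \<le> n"
proof -
  obtain A where "A \<in> L" using assms by blast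
  then have "set (replicate r A) \<subseteq> L" by auto
  then show ?thesis using assms(1) unfolding good_def
    by (metis add_leE le_trans length_replicate)
qed

text \<open>Level 1 is what non-triviality provides; higher levels come from members with more early misses.\<close>

definition level :: "nat \<Rightarrow> nat \<Rightarrow> nat \<Rightarrow> nat \<Rightarrow> bool list set \<Rightarrow> bool" where
  "level k n r t L \<longleftrightarrow> (\<forall>j. 2 \<le> j \<longrightarrow> j \<le> r \<longrightarrow> good n j (t + k * (r - j)) L)"

lemma level_good: "level k n r t L \<Longrightarrow> 2 \<le> r \<Longrightarrow> good n r t L"
  unfolding level_def by (metis add_0_right diff_self_eq_0 mult_0_right order_refl)

lemma level_trace_True:
  assumes "level k (Suc n) r t L" "1 \<le> t"
  shows "level k n r (t - 1) (trace [True] L)"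
  unfolding level_def
proof (intro allI impI)
  fix j assume "2 \<le> j" "j \<le> r"
  then have "good n j (t + k * (r - j) - 1) (trace [True] L)"
    using assms by (intro good_trace_True) (auto simp: level_def)
  then show "good n j (t - 1 + k * (r - j)) (trace [True] L)" using assms(2) by simp
qed

text \<open>A \<open>j\<close>-tuple is padded with \<open>r - j\<close> copies of \<open>A\<close>.
  For \<open>j < r\<close>, prefixes in which \<open>A\<close> has fewer than \<open>k\<close>
  misses are too short to be the witness; in the others each copy contributes at least
  \<open>k\<close>.\<close>

lemma level_witness:
  assumes good: "good n r t L" and A: "A \<in> L"
    and wit: "\<And>m. m \<le> n \<Longrightarrow> k \<le> misses m A \<or> m < t + misses m A"
  shows "level k n r t L"
  unfolding level_def good_def
proof (intro allI impI)
  fix j and As :: "bool list list"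
  assume j: "2 \<le> j" "j \<le> r" and As: "length As = j" "set As \<subseteq> L"
  let ?Bs = "As @ replicate (r - j) A"
  have "length ?Bs = r" "set ?Bs \<subseteq> L" using As j A by auto
  with good obtain m where m: "m \<le> n" "(\<Sum>A\<leftarrow>?Bs. misses m A) + t \<le> m"
    unfolding good_def by blast
  then have sum: "(\<Sum>A\<leftarrow>As. misses m A) + (r - j) * misses m A + t \<le> m"
    by (simp add: sum_list_replicate)
  show "\<exists>m\<le>n. (\<Sum>A\<leftarrow>As. misses m A) + (t + k * (r - j)) \<le> m"
  proof (cases "j = r \<or> k \<le> misses m A")
    case True
    then have "k * (r - j) \<le> (r - j) * misses m A" by (auto simp: mult.commute)
    with sum m show ?thesis by (intro exI[of _ m]) linarith
  next
    case False
    with wit m have "m < t + misses m A" by blast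
    moreover have "misses m A \<le> (r - j) * misses m A" proof -
      have "1 \<le> r - j" using False j by linarith
      then show ?thesis using mult_le_mono1[of 1 "r - j" "misses m A"] by simp
    qed
    ultimately show ?thesis using sum by linarith
  qed
qed

lemma level_1_witness:
  assumes good: "good n r t L" and A: "False # A \<in> L" and t: "1 \<le> t"
  shows "level 1 n r t L"
proof (rule level_witness[OF good A])
  fix m
  show "1 \<le> misses m (False # A) \<or> m < t + misses m (False # A)" using t by (cases m) auto
qed

text \<open>Prefixes of length at most \<open>t\<close> are too short to be the witness, and longer
  ones contain both misses.\<close>

lemma level_2_witness:
  assumes good: "good n r t L" and A: "False # A \<in> L" and t: "1 \<le> t"
    and A': "1 \<le> misses t A"
  shows "level 2 n r t L"
proof (rule level_witness[OF good A])
  fix m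
  show "2 \<le> misses m (False # A) \<or> m < t + misses m (False # A)"
  proof (cases m)
    case (Suc k)
    then show ?thesis using A' misses_mono[of t k A] by (cases "t \<le> k") auto
  qed (use t in auto)
qed

text \<open>A word and its complement together miss each coordinate exactly once, so they cannot both
  belong to \<open>L\<close>.\<close>

lemma dens_good_2_1:
  assumes good: "good n 2 1 L" and L: "L \<subseteq> cube n"
  shows "dens n L \<le> 1 / 2"
proof -
  have fin: "finite L" using finite_subset[OF L finite_cube] .
  have sum: "misses m xs + misses m (map Not xs) = m" if "m \<le> length xs" for m xs
    using that
  proof (induction xs arbitrary: m)
    case (Cons b xs)
    then show ?case by (cases m) auto
  qed simp
  have "map Not ` L \<subseteq> cube n - L"
  proof
    fix y assume "y \<in> map Not ` L"
    then obtain x where x: "x \<in> L" "y = map Not x" by blast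
    have "y \<notin> L"
    proof
      assume "y \<in> L"
      then have "length [x, y] = 2" "set [x, y] \<subseteq> L" using x by auto
      then obtain m where "m \<le> n" "(\<Sum>A\<leftarrow>[x, y]. misses m A) + 1 \<le> m"
        using good unfolding good_def by blast
      then show False using sum[of m x] x L by (auto simp: cube_def)
    qed
    then show "y \<in> cube n - L" using x L by (auto simp: cube_def)
  qed
  moreover have "inj (map Not)" by (simp add: inj_def inj_map_eq_map)
  ultimately have "card L \<le> card (cube n - L)"
    by (metis card_image card_mono finite_Diff finite_cube inj_on_subset subset_UNIV)
  also have "\<dots> = 2 ^ n - card L" using L fin by (simp add: card_Diff_subset card_cube)
  finally have "2 * card L \<le> 2 ^ n" using card_mono[OF finite_cube L] by (simp add: card_cube)
  then have "real (2 * card L) \<le> real (2 ^ n)" by (rule of_nat_mono)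
  then show ?thesis by (simp add: dens_def field_simps)
qed

section \<open>An independent set bound on the cube\<close>

definition bxor :: "bool list \<Rightarrow> bool list \<Rightarrow> bool list" where
  "bxor x y = map2 (\<noteq>) x y"

lemma xor_simps [simp]: "bxor [] [] = []" "bxor (a # x) (b # y) = (a \<noteq> b) # bxor x y"
  by (simp_all add: bxor_def)

lemma xor_cube: "x \<in> cube n \<Longrightarrow> y \<in> cube n \<Longrightarrow> bxor x y \<in> cube n"
  by (simp add: cube_def bxor_def)

lemma xor_commute: "bxor x y = bxor y x"
  unfolding bxor_def by (subst zip_commute) (auto simp: case_prod_beta o_def)

lemma xor_xor_cancel: "length x = length y \<Longrightarrow> bxor x (bxor x y) = y"
  by (induction x y rule: list_induct2) auto

lemma sum_xor_right:
  assumes "x \<in> cube n"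
  shows "(\<Sum>y\<in>cube n. f (bxor x y)) = (\<Sum>y\<in>cube n. f y)"
  by (rule sum.reindex_bij_witness[where i = "bxor x" and j = "bxor x"])
    (use assms in \<open>auto simp: xor_cube, auto simp: cube_def xor_xor_cancel\<close>)

text \<open>The form of a non-negative convolution kernel is bounded by its row sum:
  \<open>v x * v y\<close> is at most the mean of the two squares, and all rows and columns have the
  same sum.\<close>

lemma xor_form_upper:
  fixes D v :: "bool list \<Rightarrow> real"
  assumes D: "\<And>x. x \<in> cube n \<Longrightarrow> 0 \<le> D x"
  shows "(\<Sum>x\<in>cube n. \<Sum>y\<in>cube n. D (bxor x y) * (v x * v y)) \<le> (\<Sum>x\<in>cube n. D x) * (\<Sum>x\<in>cube n. (v x)\<^sup>2)"
proof -
  let ?S = "(\<Sum>x\<in>cube n. D x) * (\<Sum>x\<in>cube n. (v x)\<^sup>2)"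
  have amgm: "v x * v y \<le> ((v x)\<^sup>2 + (v y)\<^sup>2) / 2" for x y
    using sum_squares_bound[of "v x" "v y"] by simp
  have left: "(\<Sum>x\<in>cube n. \<Sum>y\<in>cube n. D (bxor x y) * (v x)\<^sup>2) = ?S"
  proof -
    have "(\<Sum>x\<in>cube n. \<Sum>y\<in>cube n. D (bxor x y) * (v x)\<^sup>2) = (\<Sum>x\<in>cube n. (\<Sum>y\<in>cube n. D (bxor x y)) * (v x)\<^sup>2)"
      by (simp add: sum_distrib_right)
    also have "\<dots> = (\<Sum>x\<in>cube n. (\<Sum>y\<in>cube n. D y) * (v x)\<^sup>2)"
      by (intro sum.cong) (simp_all add: sum_xor_right)
    finally show ?thesis by (simp add: sum_distrib_left)
  qed
  have right: "(\<Sum>x\<in>cube n. \<Sum>y\<in>cube n. D (bxor x y) * (v y)\<^sup>2) = ?S"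
    using left by (subst sum.swap) (simp add: xor_commute)
  have "(\<Sum>x\<in>cube n. \<Sum>y\<in>cube n. D (bxor x y) * (v x * v y))
      \<le> (\<Sum>x\<in>cube n. \<Sum>y\<in>cube n. D (bxor x y) * (((v x)\<^sup>2 + (v y)\<^sup>2) / 2))"
    by (intro sum_mono mult_left_mono amgm D xor_cube)
  also have "\<dots> = ((\<Sum>x\<in>cube n. \<Sum>y\<in>cube n. D (bxor x y) * (v x)\<^sup>2)
      + (\<Sum>x\<in>cube n. \<Sum>y\<in>cube n. D (bxor x y) * (v y)\<^sup>2)) / 2"
    by (simp add: sum.distrib sum_divide_distrib distrib_left add_divide_distrib)
  also have "\<dots> = ?S" using left right by simp
  finally show ?thesis .
qed

text \<open>The left-hand side is the quadratic form of the convolution operator with kernel \<open>f\<close>, whose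
  eigenvalues are the Fourier coefficients of \<open>f\<close>. For monotone \<open>f\<close> they are bounded below by the
  largest influence. The induction diagonalises the operator one coordinate at a time.\<close>

lemma xor_form_lower:
  fixes f \<phi> :: "bool list \<Rightarrow> real"
  assumes nonneg: "\<And>x. x \<in> cube n \<Longrightarrow> 0 \<le> f x"
    and mono: "\<And>x y. x \<in> cube n \<Longrightarrow> y \<in> cube n \<Longrightarrow> list_all2 (\<longrightarrow>) x y \<Longrightarrow> f x \<le> f y"
    and infl: "\<And>i. i < n \<Longrightarrow> (\<Sum>x\<in>cube n. if x ! i then f x else - f x) \<le> K"
    and K: "0 \<le> K"
  shows "- K * (\<Sum>x\<in>cube n. (\<phi> x)\<^sup>2) \<le> (\<Sum>x\<in>cube n. \<Sum>y\<in>cube n. f (bxor x y) * (\<phi> x * \<phi> y))"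
  using nonneg mono infl
proof (induction n arbitrary: f \<phi>)
  case 0
  have "0 \<le> (K + f []) * (\<phi> [])\<^sup>2" using 0(1)[of "[]"] K by simp
  then show ?case by (simp add: power2_eq_square algebra_simps)
next
  case (Suc n)
  have cube_Cons: "b # x \<in> cube (Suc n)" if "x \<in> cube n" for b x
    using that by (simp add: cube_def)
  \<comment> \<open>Change of basis in the first coordinate: the form splits into half the
    difference of an even part, with \<open>s\<close> and \<open>u\<close>, and an odd part, with
    \<open>D\<close> and \<open>v\<close>. The even part is handled by induction, the odd part by
    \<open>xor_form_upper\<close>.\<close>
  define s D u v where "s = (\<lambda>x. f (True # x) + f (False # x))"
    and "D = (\<lambda>x. f (True # x) - f (False # x))"
    and "u = (\<lambda>x. \<phi> (True # x) + \<phi> (False # x))"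
    and "v = (\<lambda>x. \<phi> (True # x) - \<phi> (False # x))"
  have ih: "- K * (\<Sum>x\<in>cube n. (u x)\<^sup>2) \<le> (\<Sum>x\<in>cube n. \<Sum>y\<in>cube n. s (bxor x y) * (u x * u y))"
  proof (rule Suc.IH)
    show "0 \<le> s x" if "x \<in> cube n" for x
      using Suc(2)[OF cube_Cons[OF that]] by (simp add: s_def)
    show "s x \<le> s y" if "x \<in> cube n" "y \<in> cube n" "list_all2 (\<longrightarrow>) x y" for x y
      unfolding s_def using that by (intro add_mono Suc(3) cube_Cons) auto
    show "(\<Sum>x\<in>cube n. if x ! i then s x else - s x) \<le> K" if "i < n" for i
    proof -
      have "(\<Sum>x\<in>cube n. if x ! i then s x else - s x)
          = (\<Sum>x\<in>cube (Suc n). if x ! Suc i then f x else - f x)"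
        unfolding sum_cube_Suc by (intro sum.cong) (auto simp: s_def)
      with Suc(4)[of "Suc i"] that show ?thesis by simp
    qed
  qed
  have diff: "(\<Sum>x\<in>cube n. \<Sum>y\<in>cube n. D (bxor x y) * (v x * v y)) \<le> K * (\<Sum>x\<in>cube n. (v x)\<^sup>2)"
  proof -
    \<comment> \<open>Monotonicity makes the derivative \<open>D\<close> non-negative; its total is
      the influence of the first coordinate.\<close>
    have "0 \<le> D x" if "x \<in> cube n" for x
      using that Suc(3)[of "False # x" "True # x"]
      by (simp add: D_def cube_Cons list_all2_refl)
    then have "(\<Sum>x\<in>cube n. \<Sum>y\<in>cube n. D (bxor x y) * (v x * v y))
        \<le> (\<Sum>x\<in>cube n. D x) * (\<Sum>x\<in>cube n. (v x)\<^sup>2)"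
      by (rule xor_form_upper)
    also have "(\<Sum>x\<in>cube n. D x) = (\<Sum>x\<in>cube (Suc n). if x ! 0 then f x else - f x)"
      unfolding sum_cube_Suc by (intro sum.cong) (auto simp: D_def)
    also have "\<dots> * (\<Sum>x\<in>cube n. (v x)\<^sup>2) \<le> K * (\<Sum>x\<in>cube n. (v x)\<^sup>2)"
      by (intro mult_right_mono Suc(4) sum_nonneg) auto
    finally show ?thesis .
  qed
  have form: "(\<Sum>x\<in>cube (Suc n). \<Sum>y\<in>cube (Suc n). f (bxor x y) * (\<phi> x * \<phi> y))
      = ((\<Sum>x\<in>cube n. \<Sum>y\<in>cube n. s (bxor x y) * (u x * u y))
        - (\<Sum>x\<in>cube n. \<Sum>y\<in>cube n. D (bxor x y) * (v x * v y))) / 2"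
  proof -
    \<comment> \<open>Equal first bits add up to \<open>False\<close>, different ones to
      \<open>True\<close>.\<close>
    have split: "f (False # z) * (a * b) + f (True # z) * (a * b') + (f (True # z) * (a' * b) + f (False # z) * (a' * b'))
        = (s z * ((a + a') * (b + b')) - D z * ((a - a') * (b - b'))) / 2" for z a a' b b'
      by (simp add: s_def D_def field_simps)
    show ?thesis
      unfolding sum_cube_Suc u_def v_def
      by (simp add: sum.distrib[symmetric] sum_subtractf[symmetric] sum_divide_distrib)
        (intro sum.cong refl split)
  qed
  have squares: "(\<Sum>x\<in>cube (Suc n). (\<phi> x)\<^sup>2) = ((\<Sum>x\<in>cube n. (u x)\<^sup>2) + (\<Sum>x\<in>cube n. (v x)\<^sup>2)) / 2"
  proof -
    have split: "a\<^sup>2 + b\<^sup>2 = ((a + b)\<^sup>2 + (a - b)\<^sup>2) / 2" for a b :: real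
      by (simp add: power2_eq_square field_simps)
    show ?thesis
      unfolding sum_cube_Suc u_def v_def
      by (simp add: sum.distrib[symmetric] sum_divide_distrib) (intro sum.cong refl split)
  qed
  show ?case
  proof -
    have "- K * ((A + B) / 2) \<le> (P - Q) / 2" if "- K * A \<le> P" "Q \<le> K * B" for A B P Q
      using that by (simp add: field_simps)
    from this[OF ih diff] show ?thesis unfolding form squares .
  qed
qed

section \<open>Dominance-closed families of words and Hoffman's bound\<close>

definition dominance_closed :: "nat \<Rightarrow> bool list set \<Rightarrow> bool" where
  "dominance_closed n L \<longleftrightarrow> L \<subseteq> cube n \<and>
     (\<forall>A\<in>L. \<forall>B\<in>cube n. (\<forall>m\<le>n. misses m B \<le> misses m A) \<longrightarrow> B \<in> L)"

lemma dominance_closed_trace: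
  assumes "dominance_closed (length p + n) L"
  shows "dominance_closed n (trace p L)"
  unfolding dominance_closed_def
proof (intro conjI ballI impI)
  show "trace p L \<subseteq> cube n" using assms by (intro trace_cube) (simp add: dominance_closed_def)
  fix A B assume A: "A \<in> trace p L" and B: "B \<in> cube n" and le: "\<forall>m\<le>n. misses m B \<le> misses m A"
  have "misses m (p @ B) \<le> misses m (p @ A)" if m: "m \<le> length p + n" for m
  proof (cases "m \<le> length p")
    case True
    then show ?thesis by (simp add: misses_append_le)
  next
    case False
    then obtain k where "m = length p + k" by (metis le_Suc_ex nat_le_linear)
    then show ?thesis using le m by (simp add: misses_append)
  qed
  moreover have "p @ B \<in> cube (length p + n)" using B by (simp add: cube_def)
  ultimately show "B \<in> trace p L"
    using assms A unfolding dominance_closed_def trace_def by blast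
qed

lemma misses_antimono: "list_all2 (\<longrightarrow>) x y \<Longrightarrow> misses m y \<le> misses m x"
proof (induction arbitrary: m rule: list_all2_induct)
  case (Cons a x b y)
  show ?case
  proof (cases m)
    case (Suc k)
    then show ?thesis using Cons(1) Cons.IH[of k] by auto
  qed simp
qed simp

lemma misses_update_le: "misses m (x[k := b]) \<le> Suc (misses m x)"
proof (induction x arbitrary: m k)
  case (Cons a x)
  show ?case
  proof (cases m)
    case (Suc m')
    then show ?thesis using Cons[of m' "k - 1"] by (cases k) auto
  qed simp
qed simp

text \<open>Moving a hit from position \<open>i\<close> to a missed position 0 never increases the
  misses of a prefix, so this injection stays in \<open>L\<close>. Hence the first coordinate is the
  most influential one.\<close>

lemma dominance_closed_first_coordinate:
  assumes L: "dominance_closed n L" and i: "i < n"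
  shows "card {x \<in> L. x ! i} \<le> card {x \<in> L. x ! 0}"
proof (cases i)
  case (Suc k)
  have fin: "finite L" using L finite_subset[OF _ finite_cube] by (auto simp: dominance_closed_def)
  let ?f = "\<lambda>x. x[0 := True, i := False]"
  have "card {x \<in> L. x ! i \<and> \<not> x ! 0} \<le> card {x \<in> L. \<not> x ! i \<and> x ! 0}"
  proof (rule card_inj_on_le[of ?f])
    show "inj_on ?f {x \<in> L. x ! i \<and> \<not> x ! 0}"
    proof (rule inj_on_inverseI)
      fix x assume x: "x \<in> {x \<in> L. x ! i \<and> \<not> x ! 0}"
      then have len: "length x = n" using L by (auto simp: dominance_closed_def cube_def)
      show "(\<lambda>y. y[0 := False, i := True]) (?f x) = x"
        by (rule nth_equalityI) (use x i Suc len in \<open>auto simp: nth_list_update\<close>)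
    qed
    show "?f ` {x \<in> L. x ! i \<and> \<not> x ! 0} \<subseteq> {x \<in> L. \<not> x ! i \<and> x ! 0}"
    proof
      fix y assume "y \<in> ?f ` {x \<in> L. x ! i \<and> \<not> x ! 0}"
      then obtain x where x: "x \<in> L" "x ! i" "\<not> x ! 0" "y = ?f x" by blast
      have len: "length x = n" using L x by (auto simp: dominance_closed_def cube_def)
      then obtain x' where x': "x = False # x'" using x(3) i by (cases x) auto
      have "misses m y \<le> misses m x" for m
        using misses_update_le[of "m - 1" x' k False] by (cases m) (auto simp: x x' Suc)
      moreover have "y \<in> cube n" using x len by (simp add: cube_def)
      ultimately have "y \<in> L" using L x(1) unfolding dominance_closed_def by blast
      then show "y \<in> {x \<in> L. \<not> x ! i \<and> x ! 0}" using x i Suc len by simp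
    qed
  qed (use fin in simp)
  moreover have "card {x \<in> L. x ! i} = card {x \<in> L. x ! i \<and> x ! 0} + card {x \<in> L. x ! i \<and> \<not> x ! 0}"
    using fin by (subst card_Un_disjoint[symmetric]) (auto intro: arg_cong[where f = card])
  moreover have "card {x \<in> L. x ! 0} = card {x \<in> L. x ! i \<and> x ! 0} + card {x \<in> L. \<not> x ! i \<and> x ! 0}"
    using fin by (subst card_Un_disjoint[symmetric]) (auto intro: arg_cong[where f = card])
  ultimately show ?thesis by simp
qed simp

text \<open>Hoffman's bound for the Cayley graph of \<open>F\<^sub>2\<^sup>n\<close> with connection set \<open>H\<close>, in which \<open>G\<close> is
  independent.\<close>

lemma xor_free_bias:
  assumes H: "dominance_closed (Suc n) H" and G: "G \<subseteq> cube (Suc n)"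
    and free: "\<And>x y. x \<in> G \<Longrightarrow> y \<in> G \<Longrightarrow> bxor x y \<notin> H"
  shows "dens n (trace [False] H) \<le> (1 - 2 * dens (Suc n) G) * dens n (trace [True] H)"
proof -
  let ?N = "Suc n" and ?C = "cube (Suc n)"
  have HC: "H \<subseteq> ?C" using H by (simp add: dominance_closed_def)
  have finH: "finite H" and finG: "finite G"
    using finite_subset[OF HC finite_cube] finite_subset[OF G finite_cube] .
  define h1 h0 g c where "h1 = real (card (trace [True] H))" and "h0 = real (card (trace [False] H))"
    and "g = real (card G)" and "c = g / 2 ^ ?N"
  let ?f = "\<lambda>x. of_bool (x \<in> H) :: real"
  \<comment> \<open>The indicator of \<open>G\<close> minus its mean \<open>c\<close>: this removes
    the component along the constant functions, as usual in Hoffman's argument.\<close>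
  let ?\<phi> = "\<lambda>x. of_bool (x \<in> G) - c"
  have tr: "trace [b] H \<subseteq> cube n" for b using trace_cube_Suc[OF HC] .
  have sum_trace: "(\<Sum>x\<in>cube n. ?f (b # x)) = real (card (trace [b] H))" for b
  proof -
    have "(\<Sum>x\<in>cube n. ?f (b # x)) = (\<Sum>x\<in>cube n. of_bool (x \<in> trace [b] H))"
      by (simp add: trace_def)
    also have "\<dots> = real (card (trace [b] H))"
      using tr[of b] by (simp add: sum_of_bool_eq Int_absorb1 Int_def[symmetric])
    finally show ?thesis .
  qed
  have sumH: "(\<Sum>x\<in>?C. ?f x) = h1 + h0"
    by (simp add: sum_cube_Suc sum.distrib sum_trace h1_def h0_def)
  have sumH': "(\<Sum>x\<in>?C. ?f x) = real (card H)"
    using HC by (simp add: sum_of_bool_eq Int_absorb1 Int_def[symmetric])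
  have sumG: "(\<Sum>x\<in>?C. of_bool (x \<in> G)) = g"
    using G by (simp add: sum_of_bool_eq Int_absorb1 Int_def[symmetric] g_def)
  have first: "(\<Sum>x\<in>?C. if x ! 0 then ?f x else - ?f x) = h1 - h0"
    by (simp add: sum_cube_Suc sum_subtractf sum_trace h1_def h0_def)
  have signed: "(\<Sum>x\<in>?C. if x ! i then ?f x else - ?f x) = 2 * real (card {x \<in> H. x ! i}) - (h1 + h0)" for i
  proof -
    have "(\<Sum>x\<in>?C. if x ! i then ?f x else - ?f x)
        = (\<Sum>x\<in>?C. 2 * of_bool (x \<in> {x \<in> H. x ! i}) - ?f x)"
      by (intro sum.cong) auto
    also have "\<dots> = 2 * (\<Sum>x\<in>?C. of_bool (x \<in> {x \<in> H. x ! i})) - (h1 + h0)"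
      by (simp only: sum_subtractf sum_distrib_left sumH)
    also have "(\<Sum>x\<in>?C. of_bool (x \<in> {x \<in> H. x ! i})) = real (card {x \<in> H. x ! i})"
    proof -
      have "?C \<inter> {x. x \<in> H \<and> x ! i} = {x \<in> H. x ! i}" using HC by auto
      then show ?thesis by (simp add: sum_of_bool_eq)
    qed
    finally show ?thesis .
  qed
  have mono: "?f x \<le> ?f y" if "x \<in> ?C" "y \<in> ?C" "list_all2 (\<longrightarrow>) x y" for x y
    using that H misses_antimono[OF that(3)] unfolding dominance_closed_def by auto
  have K: "0 \<le> h1 - h0"
  proof -
    have "?f (False # x) \<le> ?f (True # x)" if "x \<in> cube n" for x
      using that by (intro mono) (auto simp: cube_def list_all2_refl)
    then have "(\<Sum>x\<in>cube n. ?f (False # x)) \<le> (\<Sum>x\<in>cube n. ?f (True # x))" by (rule sum_mono)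
    then show ?thesis by (simp add: sum_trace h1_def h0_def)
  qed
  \<comment> \<open>By \<open>dominance_closed_first_coordinate\<close>, \<open>h1 - h0\<close>
    bounds every influence and can serve as \<open>K\<close>.\<close>
  have low: "- (h1 - h0) * (\<Sum>x\<in>?C. (?\<phi> x)\<^sup>2) \<le> (\<Sum>x\<in>?C. \<Sum>y\<in>?C. ?f (bxor x y) * (?\<phi> x * ?\<phi> y))"
  proof (rule xor_form_lower[OF _ mono _ K])
    show "(\<Sum>x\<in>?C. if x ! i then ?f x else - ?f x) \<le> h1 - h0" if "i < ?N" for i
      using dominance_closed_first_coordinate[OF H that] signed[of i] signed[of 0] first by simp
  qed auto
  have squares: "(\<Sum>x\<in>?C. (?\<phi> x)\<^sup>2) = g - 2 * c * g + c\<^sup>2 * 2 ^ ?N"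
  proof -
    have "(\<Sum>x\<in>?C. (?\<phi> x)\<^sup>2) = (\<Sum>x\<in>?C. of_bool (x \<in> G) - 2 * c * of_bool (x \<in> G) + c\<^sup>2)"
      by (intro sum.cong) (auto simp: power2_eq_square algebra_simps)
    also have "\<dots> = g - 2 * c * g + real (card ?C) * c\<^sup>2"
      by (simp only: sum.distrib sum_subtractf sum_distrib_left[symmetric] sumG sum_constant)
    finally show ?thesis by (simp add: card_cube)
  qed
  have form: "(\<Sum>x\<in>?C. \<Sum>y\<in>?C. ?f (bxor x y) * (?\<phi> x * ?\<phi> y)) = - 2 * c * (g * (h1 + h0)) + c\<^sup>2 * (2 ^ ?N * (h1 + h0))"
  proof -
    have left: "(\<Sum>x\<in>?C. \<Sum>y\<in>?C. ?f (bxor x y) * of_bool (x \<in> G)) = g * (h1 + h0)"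
    proof -
      have "(\<Sum>x\<in>?C. \<Sum>y\<in>?C. ?f (bxor x y) * of_bool (x \<in> G)) = (\<Sum>x\<in>?C. (\<Sum>y\<in>?C. ?f (bxor x y)) * of_bool (x \<in> G))"
        by (simp add: sum_distrib_right)
      also have "\<dots> = (\<Sum>x\<in>?C. (h1 + h0) * of_bool (x \<in> G))"
        by (intro sum.cong refl) (simp only: sum_xor_right[where f = ?f] sumH)
      finally show ?thesis by (simp only: sum_distrib_left[symmetric] sumG mult.commute)
    qed
    have right: "(\<Sum>x\<in>?C. \<Sum>y\<in>?C. ?f (bxor x y) * of_bool (y \<in> G)) = g * (h1 + h0)"
      using left by (subst sum.swap) (simp add: xor_commute)
    have all: "(\<Sum>x\<in>?C. \<Sum>y\<in>?C. ?f (bxor x y)) = 2 ^ ?N * (h1 + h0)"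
    proof -
      have "(\<Sum>x\<in>?C. \<Sum>y\<in>?C. ?f (bxor x y)) = (\<Sum>x\<in>?C. h1 + h0)"
        by (intro sum.cong refl) (simp only: sum_xor_right[where f = ?f] sumH)
      then show ?thesis by (simp add: card_cube)
    qed
    \<comment> \<open>The product of the two indicators of \<open>G\<close> drops out because
      \<open>?f\<close> vanishes on sums of two members of \<open>G\<close>.\<close>
    have "?f (bxor x y) * (?\<phi> x * ?\<phi> y)
        = c\<^sup>2 * ?f (bxor x y) - c * (?f (bxor x y) * of_bool (x \<in> G)) - c * (?f (bxor x y) * of_bool (y \<in> G))" for x y
      using free[of x y] by (auto simp: algebra_simps power2_eq_square)
    then have "(\<Sum>x\<in>?C. \<Sum>y\<in>?C. ?f (bxor x y) * (?\<phi> x * ?\<phi> y))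
        = c\<^sup>2 * (\<Sum>x\<in>?C. \<Sum>y\<in>?C. ?f (bxor x y))
          - c * (\<Sum>x\<in>?C. \<Sum>y\<in>?C. ?f (bxor x y) * of_bool (x \<in> G))
          - c * (\<Sum>x\<in>?C. \<Sum>y\<in>?C. ?f (bxor x y) * of_bool (y \<in> G))"
      by (simp only: sum_subtractf sum_distrib_left)
    then show ?thesis unfolding left right all by (simp add: algebra_simps)
  qed
  have "c * 2 ^ ?N = g" by (simp add: c_def)
  then have cg: "c\<^sup>2 * 2 ^ ?N = c * g" by (simp add: power2_eq_square)
  have "- (h1 - h0) * (g - 2 * c * g + c\<^sup>2 * 2 ^ ?N)
      \<le> - 2 * c * (g * (h1 + h0)) + (c\<^sup>2 * 2 ^ ?N) * (h1 + h0)"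
    using low unfolding squares form by (simp only: mult.assoc)
  then have "- (h1 - h0) * (g - c * g) \<le> - c * (g * (h1 + h0))"
    unfolding cg by (simp add: algebra_simps)
  then have key: "0 \<le> g * ((h1 - h0) * (1 - c) - c * (h1 + h0))"
    by (simp add: algebra_simps)
  have "h0 \<le> (1 - 2 * c) * h1"
  \<comment> \<open>If \<open>G\<close> is empty, the factor \<open>g\<close> cannot be cancelled,
    but then the claim is just \<open>h0 \<le> h1\<close>.\<close>
  proof (cases "g = 0")
    case True
    then show ?thesis using K by (simp add: c_def)
  next
    case False
    then have "0 < g" by (simp add: g_def)
    with key have "0 \<le> (h1 - h0) * (1 - c) - c * (h1 + h0)" by (simp add: zero_le_mult_iff)
    then show ?thesis by (simp add: algebra_simps)
  qed
  then have "h0 / 2 ^ n \<le> (1 - 2 * c) * h1 / 2 ^ n" by (rule divide_right_mono) simp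
  then show ?thesis by (simp add: dens_def h0_def h1_def c_def g_def)
qed

section \<open>Bounds from prefixes\<close>

text \<open>Closing a family raises its density, if anything, and preserves walk conditions, so
  upper bounds may be proved for dominance-closed families alone.\<close>

definition dominance_closure :: "nat \<Rightarrow> bool list set \<Rightarrow> bool list set" where
  "dominance_closure n L = {B \<in> cube n. \<exists>A\<in>L. \<forall>m\<le>n. misses m B \<le> misses m A}"

lemma subset_dominance_closure: "L \<subseteq> cube n \<Longrightarrow> L \<subseteq> dominance_closure n L"
  by (auto simp: dominance_closure_def)

lemma dominance_closed_closure: "dominance_closed n (dominance_closure n L)"
  unfolding dominance_closed_def dominance_closure_def by (auto, meson le_trans)

lemma good_dominance_closure:
  assumes "good n r t L"
  shows "good n r t (dominance_closure n L)"
  unfolding good_def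
proof (intro allI impI)
  fix As :: "bool list list" assume As: "length As = r" "set As \<subseteq> dominance_closure n L"
  then have "\<forall>B\<in>set As. \<exists>A\<in>L. \<forall>m\<le>n. misses m B \<le> misses m A"
    by (auto simp: dominance_closure_def)
  then obtain c where c: "\<And>B. B \<in> set As \<Longrightarrow> c B \<in> L"
    "\<And>B m. B \<in> set As \<Longrightarrow> m \<le> n \<Longrightarrow> misses m B \<le> misses m (c B)"
    by metis
  have "length (map c As) = r" "set (map c As) \<subseteq> L" using As c by auto
  with assms obtain m where m: "m \<le> n" "(\<Sum>A\<leftarrow>map c As. misses m A) + t \<le> m"
    unfolding good_def by blast
  have "(\<Sum>A\<leftarrow>As. misses m A) \<le> (\<Sum>A\<leftarrow>As. misses m (c A))"
    using c(2) m(1) by (intro sum_list_mono)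
  with m show "\<exists>m\<le>n. (\<Sum>A\<leftarrow>As. misses m A) + t \<le> m"
    by (intro exI[of _ m]) (simp add: o_def)
qed

lemma level_dominance_closure: "level k n r t L \<Longrightarrow> level k n r t (dominance_closure n L)"
  by (simp add: level_def good_dominance_closure)

text \<open>Where \<open>x\<close> and \<open>y\<close> both hit, \<open>bxor x y\<close> misses, so
  each coordinate counts at least once.\<close>

lemma misses_bxor:
  assumes "length x = length y" "k \<le> length x"
  shows "k \<le> misses k x + misses k y + misses k (bxor x y)"
  using assms
proof (induction x y arbitrary: k rule: list_induct2)
  case (Cons a x b y)
  show ?case
  proof (cases k)
    case (Suc k')
    then show ?thesis using Cons(2)[of k'] Cons(3) by auto
  qed simp
qed simp

lemma misses_replicate_True [simp]: "misses m (replicate k True) = 0"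
  by (simp add: misses_def)

lemma misses_pos: "p \<in> cube t \<Longrightarrow> p \<noteq> replicate t True \<Longrightarrow> 0 < misses t p"
proof (induction t arbitrary: p)
  case (Suc t)
  then obtain b q where "p = b # q" "q \<in> cube t" by (auto simp: cube_Suc)
  with Suc show ?case by (cases b) auto
qed simp

text \<open>If \<open>x\<close> and \<open>y\<close> continue the full prefix, then \<open>bxor x y\<close> cannot continue a prefix with
  a miss, since the three together miss every later coordinate at least once. So the members with full prefix limit the bias of all other traces.\<close>

lemma prefix_bound:
  assumes dc: "dominance_closed (t + Suc n) L"
    and g3: "good (t + Suc n) 3 t L" and g2: "good (t + Suc n) 2 (t + 1) L"
    and b: "\<And>p. p \<in> cube t \<Longrightarrow> 0 < misses t p \<Longrightarrow> dens n (trace (p @ [True]) L) \<le> b (misses t p)"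
    and b0: "b 0 = 0" and S: "(\<Sum>p\<in>cube t. b (misses t p)) \<le> S" "S \<le> 1"
  shows "2 ^ t * dens (t + Suc n) L \<le> (1 + S) / 2"
proof -
  let ?ones = "replicate t True"
  have LC: "L \<subseteq> cube (t + Suc n)" using dc by (simp add: dominance_closed_def)
  define G where "G = trace ?ones L"
  define g where "g = dens (Suc n) G"
  have GC: "G \<subseteq> cube (Suc n)" using LC trace_cube[of L ?ones] by (simp add: G_def)
  \<comment> \<open>The full prefix uses up \<open>t\<close> of the level \<open>t + 1\<close> of
    pairs. What is left still excludes complementary words.\<close>
  have "good (Suc n) 2 1 G" unfolding G_def
    by (rule good_trace[where t = "t + 1"]) (use g2 in auto)
  then have g_half: "g \<le> 1 / 2" unfolding g_def using GC by (rule dens_good_2_1)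
  \<comment> \<open>If \<open>a\<close> is the density after one further hit, the bias bound limits
    the density after a miss to \<open>(1 - 2 * g) * a\<close>; the mean of both is
    \<open>(1 - g) * a\<close>.\<close>
  have other: "dens (Suc n) (trace p L) \<le> (1 - g) * b (misses t p)"
    if p: "p \<in> cube t" "p \<noteq> ?ones" for p
  proof -
    have len: "length p = t" using p by (simp add: cube_def)
    have pos: "0 < misses t p" using p by (rule misses_pos)
    have dcp: "dominance_closed (Suc n) (trace p L)"
      using dc len by (intro dominance_closed_trace) simp
    have "bxor x y \<notin> trace p L" if xy: "x \<in> G" "y \<in> G" for x y
    proof
      assume "bxor x y \<in> trace p L"
      then have "set [?ones @ x, ?ones @ y, p @ bxor x y] \<subseteq> L" "length [?ones @ x, ?ones @ y, p @ bxor x y] = 3"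
        using xy by (auto simp: G_def trace_def)
      with g3 obtain m where m: "m \<le> t + Suc n"
        "(\<Sum>A\<leftarrow>[?ones @ x, ?ones @ y, p @ bxor x y]. misses m A) + t \<le> m"
        unfolding good_def by blast
      then obtain k where k: "m = t + k" by (metis add_leE le_iff_add)
      have "length x = Suc n" "length y = Suc n" using xy GC by (auto simp: cube_def)
      with k m(1) have "k \<le> misses k x + misses k y + misses k (bxor x y)"
        by (intro misses_bxor) auto
      moreover have "misses m (q @ z) = misses t q + misses k z" if "length q = t" for q z
        using misses_append[of q k z] that k by simp
      ultimately show False using m k pos len by simp
    qed
    then have "dens n (trace [False] (trace p L)) \<le> (1 - 2 * g) * dens n (trace [True] (trace p L))"
      unfolding g_def by (intro xor_free_bias[OF dcp GC])
    moreover have "trace p L \<subseteq> cube (Suc n)" using dcp by (simp add: dominance_closed_def)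
    ultimately have "dens (Suc n) (trace p L) \<le> (1 - g) * dens n (trace (p @ [True]) L)"
      by (simp add: dens_Suc trace_trace field_simps)
    also have "\<dots> \<le> (1 - g) * b (misses t p)"
      using b[OF p(1) pos] g_half by (intro mult_left_mono) auto
    finally show ?thesis .
  qed
  have "2 ^ t * dens (t + Suc n) L = (\<Sum>p\<in>cube t. dens (Suc n) (trace p L))"
    by (rule dens_prefix_sum[OF LC])
  also have "\<dots> = g + (\<Sum>p\<in>cube t - {?ones}. dens (Suc n) (trace p L))"
    by (subst sum.remove[of _ ?ones]) (auto simp: g_def G_def cube_def finite_cube[unfolded cube_def])
  also have "(\<Sum>p\<in>cube t - {?ones}. dens (Suc n) (trace p L)) \<le> (\<Sum>p\<in>cube t - {?ones}. (1 - g) * b (misses t p))"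
    by (intro sum_mono other) auto
  also have "\<dots> = (\<Sum>p\<in>cube t. (1 - g) * b (misses t p))"
    by (subst (2) sum.remove[of _ ?ones]) (auto simp: b0 cube_def finite_cube[unfolded cube_def])
  also have "\<dots> = (1 - g) * (\<Sum>p\<in>cube t. b (misses t p))" by (simp add: sum_distrib_left)
  also have "\<dots> \<le> (1 - g) * S" using S g_half by (intro mult_left_mono) auto
  also have "g + (1 - g) * S = S + g * (1 - S)" by (simp add: algebra_simps)
  \<comment> \<open>Since \<open>S \<le> 1\<close>, the expression grows with \<open>g\<close> and
    is largest at \<open>g = 1 / 2\<close>.\<close>
  also have "\<dots> \<le> S + 1 / 2 * (1 - S)" using g_half S by (intro add_left_mono mult_right_mono) auto
  also have "\<dots> = (1 + S) / 2" by (simp add: field_simps)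
  finally show ?thesis by simp
qed

text \<open>\<open>1 / 2 ^ t\<close> is the density of the words that hit all of the first
  \<open>t\<close> coordinates.\<close>

definition trivial_bound :: "nat \<Rightarrow> nat \<Rightarrow> bool" where
  "trivial_bound r n \<longleftrightarrow> (\<forall>t L. L \<subseteq> cube n \<longrightarrow> r + t + 1 \<le> 2 ^ r \<longrightarrow> good n r t L \<longrightarrow>
     dens n L \<le> 1 / 2 ^ t)"

text \<open>The value is the density of the words with at most one miss among the first
  \<open>r + t\<close> coordinates, a Hamming ball. For \<open>r = 2\<close> and
  \<open>t = 0\<close> the whole cube has level 1, so this pair is left out.\<close>

definition ball_bound :: "nat \<Rightarrow> nat \<Rightarrow> bool" where
  "ball_bound r n \<longleftrightarrow> (\<forall>t L. L \<subseteq> cube n \<longrightarrow> r + t + 1 \<le> 2 ^ r \<longrightarrow> 1 \<le> t \<or> 3 \<le> r \<longrightarrow>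
     level 1 n r t L \<longrightarrow> dens n L \<le> real (r + t + 1) / 2 ^ (r + t))"

lemma trivial_boundD:
  "trivial_bound r n \<Longrightarrow> L \<subseteq> cube n \<Longrightarrow> good n r t L \<Longrightarrow> r + t + 1 \<le> 2 ^ r \<Longrightarrow> dens n L \<le> 1 / 2 ^ t"
  by (simp add: trivial_bound_def)

lemma ball_boundD:
  "ball_bound r n \<Longrightarrow> L \<subseteq> cube n \<Longrightarrow> level 1 n r t L \<Longrightarrow> r + t + 1 \<le> 2 ^ r \<Longrightarrow>
    1 \<le> t \<or> 3 \<le> r \<Longrightarrow> dens n L \<le> real (r + t + 1) / 2 ^ (r + t)"
  unfolding ball_bound_def by blast

lemma good_0_empty: "good 0 r t L \<Longrightarrow> 1 \<le> t \<Longrightarrow> L = {}"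
  using good_nonempty by fastforce

lemma dens_Suc_le:
  assumes L: "L \<subseteq> cube (Suc n)" "trace [False] L = {}"
    and le: "dens n (trace [True] L) \<le> 1 / 2 ^ t"
  shows "dens (Suc n) L \<le> 1 / 2 ^ Suc t"
proof -
  have "dens (Suc n) L = dens n (trace [True] L) / 2" using dens_Suc[OF L(1)] L(2) by simp
  also have "\<dots> \<le> 1 / 2 ^ t / 2" using le by (rule divide_right_mono) simp
  finally show ?thesis by simp
qed

text \<open>If no word misses the first coordinate, it is removed. Otherwise
  \<open>level_1_witness\<close> makes the ball bound available, which is at most
  \<open>1 / 2 ^ t\<close> since \<open>r + t + 1 \<le> 2 ^ r\<close>.\<close>

lemma trivial_bound_if_ball_bound:
  assumes "\<And>m. m \<le> n \<Longrightarrow> ball_bound r m"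
  shows "trivial_bound r n"
  using assms
proof (induction n)
  case 0
  show ?case
    unfolding trivial_bound_def
  proof (intro allI impI)
    fix t L assume L: "L \<subseteq> cube 0" "good 0 r t L"
    show "dens 0 L \<le> 1 / 2 ^ t"
    proof (cases t)
      case 0
      then show ?thesis using dens_le_1[OF L(1)] by simp
    next
      case (Suc k)
      then show ?thesis using good_0_empty[OF L(2)] by simp
    qed
  qed
next
  case (Suc n)
  show ?case
    unfolding trivial_bound_def
  proof (intro allI impI)
    fix t L assume L: "L \<subseteq> cube (Suc n)" "r + t + 1 \<le> 2 ^ r" "good (Suc n) r t L"
    show "dens (Suc n) L \<le> 1 / 2 ^ t"
    proof (cases "t = 0")
      case True
      then show ?thesis using dens_le_1[OF L(1)] by simp
    next
      case False
      then have t: "1 \<le> t" by simp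
      show ?thesis
      proof (cases "trace [False] L = {}")
        case True
        have "dens n (trace [True] L) \<le> 1 / 2 ^ (t - 1)"
          using Suc L trace_cube_Suc[OF L(1)] good_trace_True[OF L(3) t]
          unfolding trivial_bound_def by simp
        then show ?thesis
          using dens_Suc_le[OF L(1) True, of "t - 1"] t by simp
      next
        case False
        then obtain A where "False # A \<in> L" by (auto simp: trace_def)
        then have "level 1 (Suc n) r t L" using L t by (intro level_1_witness)
        then have "dens (Suc n) L \<le> real (r + t + 1) / 2 ^ (r + t)"
          using Suc(2)[of "Suc n"] L t unfolding ball_bound_def by blast
        also have "\<dots> \<le> 2 ^ r / 2 ^ (r + t)"
        proof (intro divide_right_mono)
          have "real (r + t + 1) \<le> real (2 ^ r)" using L(2) by (rule of_nat_mono)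
          then show "real (r + t + 1) \<le> 2 ^ r" by simp
        qed simp
        also have "\<dots> = 1 / 2 ^ t" by (simp add: power_add)
        finally show ?thesis .
      qed
    qed
  qed
qed

text \<open>Extends the trivial bound at \<open>T\<close> to higher levels. A hit lowers the excess
  \<open>u\<close> by 1 and a miss raises it by \<open>r - 1\<close>, so \<open>\<beta> ^ u\<close>
  fits the recursion as soon as \<open>1 + \<beta> ^ r \<le> 2 * \<beta>\<close>.\<close>

lemma geometric_bound:
  fixes \<beta> :: real
  assumes triv: "\<And>m. m \<le> n \<Longrightarrow> trivial_bound r m" and T: "1 \<le> T" "r + T + 1 \<le> 2 ^ r"
    and \<beta>: "0 < \<beta>" "1 + \<beta> ^ r \<le> 2 * \<beta>"
    and L: "L \<subseteq> cube n" "good n r (T + u) L"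
  shows "dens n L \<le> \<beta> ^ u / 2 ^ T"
  using triv L
proof (induction n arbitrary: L u)
  case 0
  then show ?case using good_0_empty[of r "T + u" L] T \<beta> by simp
next
  case (Suc n)
  show ?case
  proof (cases u)
    case 0
    then show ?thesis using Suc(2)[of "Suc n"] Suc(3,4) T unfolding trivial_bound_def by auto
  next
    case (Suc v)
    have pos: "1 \<le> T + u" using T by simp
    have "good n r (T + v) (trace [True] L)"
      using good_trace_True[OF Suc.prems(3) pos] Suc by simp
    then have 1: "dens n (trace [True] L) \<le> \<beta> ^ v / 2 ^ T"
      using Suc.prems trace_cube_Suc[OF Suc.prems(2)] by (intro Suc.IH) auto
    have "good n r (T + (v + r)) (trace [False] L)"
      using good_trace_False[OF Suc.prems(3) pos] Suc by (simp add: algebra_simps)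
    then have 0: "dens n (trace [False] L) \<le> \<beta> ^ (v + r) / 2 ^ T"
      using Suc.prems trace_cube_Suc[OF Suc.prems(2)] by (intro Suc.IH) auto
    have "dens (Suc n) L \<le> (\<beta> ^ v / 2 ^ T + \<beta> ^ (v + r) / 2 ^ T) / 2"
      using 0 1 dens_Suc[OF Suc.prems(2)] by simp
    also have "\<dots> = \<beta> ^ v * (1 + \<beta> ^ r) / 2 / 2 ^ T" by (simp add: power_add field_simps)
    also have "\<dots> \<le> \<beta> ^ v * (2 * \<beta>) / 2 / 2 ^ T"
      using \<beta> by (intro divide_right_mono mult_left_mono) auto
    also have "\<dots> = \<beta> ^ u / 2 ^ T" using Suc by simp
    finally show ?thesis .
  qed
qed

text \<open>The \<open>u\<close> coordinates that all words hit are peeled off with a factor 1/2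
  each, so the range condition concerns \<open>v\<close> alone.\<close>

lemma prefix_trivial_bound:
  assumes triv: "\<And>m. m \<le> n \<Longrightarrow> trivial_bound r m" and v: "r + v + 1 \<le> 2 ^ r"
    and L: "L \<subseteq> cube n" "good n r (u + v) L" and hits: "\<And>A. A \<in> L \<Longrightarrow> misses u A = 0"
  shows "dens n L \<le> 1 / 2 ^ (u + v)"
  using triv L hits
proof (induction u arbitrary: n L)
  case 0
  then show ?case using v unfolding trivial_bound_def by simp
next
  case (Suc u)
  show ?case
  proof (cases n)
    case 0
    then show ?thesis using Suc good_0_empty[of r "Suc u + v" L] by simp
  next
    case (Suc m)
    have L: "L \<subseteq> cube (Suc m)" using Suc.prems Suc by simp
    have "trace [False] L = {}" using Suc.prems(4) by (force simp: trace_def)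
    moreover have "dens m (trace [True] L) \<le> 1 / 2 ^ (u + v)"
    proof (rule Suc.IH)
      show "good m r (u + v) (trace [True] L)"
        using Suc.prems(3) Suc good_trace_True[of m r "Suc u + v" L] by simp
      show "misses u A = 0" if "A \<in> trace [True] L" for A
        using Suc.prems(4)[of "True # A"] that by (simp add: trace_def)
    qed (use Suc.prems Suc trace_cube_Suc[OF L] in auto)
    ultimately show ?thesis using dens_Suc_le[OF L, of "u + v"] Suc by simp
  qed
qed

section \<open>Families with two early misses\<close>

text \<open>With \<open>y = 1 / 2 ^ (r - 1)\<close> one has \<open>2 * \<beta> = 1 + y\<close>, and
  the first claim reduces to \<open>(1 + y) ^ r \<le> 2\<close>.\<close>

lemma geometric_rate:
  assumes r: "3 \<le> r" and \<beta>: "\<beta> = 1 / 2 + 1 / 2 ^ r"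
  shows "1 + \<beta> ^ r \<le> 2 * (\<beta> :: real)" and "4 \<le> r \<Longrightarrow> (2 * \<beta>) ^ (r - 1) \<le> 3 / 2"
proof -
  obtain k where k: "r = Suc k" "2 \<le> k" using r by (cases r) auto
  define y :: real where "y = 1 / 2 ^ k"
  have 2: "2 * \<beta> = 1 + y" using k \<beta> by (simp add: y_def)
  have y: "0 < y" "y \<le> 1 / 4"
    using k power_increasing[of 2 k "2 :: real"] by (auto simp: y_def field_simps)
  have pow: "(1 + y) ^ k \<le> 3 / 2" if "3 \<le> k"
  proof (cases "k = 3")
    case True
    then show ?thesis by (simp add: y_def power3_eq_cube)
  next
    case False
    \<comment> \<open>Bernoulli's inequality for \<open>(1 - y) ^ k\<close> together with
      \<open>(1 + y) * (1 - y) \<le> 1\<close> gives even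
      \<open>(1 + y) ^ k \<le> 4 / 3\<close>.\<close>
    have "4 * k \<le> 2 ^ k" if "4 \<le> k" for k :: nat
      using that by (induction k rule: dec_induct) auto
    then have "4 * k \<le> 2 ^ k" using that False by simp
    then have "real (4 * k) \<le> real (2 ^ k)" by (rule of_nat_mono)
    then have "real k * y \<le> 1 / 4" by (simp add: y_def field_simps)
    then have "3 / 4 \<le> 1 + real k * (- y)" by simp
    also have "\<dots> \<le> (1 - y) ^ k" using Bernoulli_inequality[of "- y" k] y by simp
    finally have "3 / 4 * (1 + y) ^ k \<le> (1 - y) ^ k * (1 + y) ^ k"
      using y by (intro mult_right_mono) auto
    also have "\<dots> = (1 - y\<^sup>2) ^ k" by (simp add: power_mult_distrib[symmetric] power2_eq_square algebra_simps)
    also have "\<dots> \<le> 1" using y by (intro power_le_one) (auto simp: power_le_one)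
    finally show ?thesis by simp
  qed
  show "(2 * \<beta>) ^ (r - 1) \<le> 3 / 2" if "4 \<le> r" using pow that k 2 by simp
  have "(1 + y) ^ r \<le> 2"
  proof (cases "k = 2")
    case True
    then show ?thesis using k by (simp add: y_def eval_nat_numeral)
  next
    case False
    then have "(1 + y) ^ k * (1 + y) \<le> 3 / 2 * (5 / 4)"
      using pow k y by (intro mult_mono) auto
    then show ?thesis using k by (simp add: mult.commute)
  qed
  then have "(2 * \<beta>) ^ r \<le> 2" using 2 by simp
  then have "\<beta> ^ r \<le> y" using k by (simp add: power_mult_distrib y_def field_simps)
  then show "1 + \<beta> ^ r \<le> 2 * \<beta>" using 2 by simp
qed

lemma two_mult_add_four_le_power: "4 \<le> r \<Longrightarrow> 2 * r + 4 \<le> (2 :: nat) ^ r"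
  by (induction r rule: dec_induct) auto

text \<open>The start comes from the ball bound for \<open>r - 1\<close>. Each step adds the scaled
  density of the words with a first miss: at most 1 within the range of the trivial bound and at
  most 3/2 beyond it. The truncated difference counts the steps of the second kind.\<close>

lemma level_2_bound:
  assumes r: "4 \<le> r" and ball: "\<And>m. ball_bound (r - 1) m"
    and triv: "\<And>m. m < n \<Longrightarrow> trivial_bound r m"
    and T: "T = 2 ^ r - r - 1" and t: "t \<le> T"
    and L: "L \<subseteq> cube n" "level 2 n r t L"
  shows "2 ^ (r + t) * dens n L \<le> (real r + 2) / 2 + real t + real (t + r - 1 - T) / 2"
  using t triv L
proof (induction t arbitrary: n L)
  case 0
  have "2 * r + 4 \<le> 2 ^ r" using r by (rule two_mult_add_four_le_power)
  then have T': "r - 1 \<le> T" using T r by linarith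
  have "(2 :: nat) ^ r = 2 * 2 ^ (r - 1)" using r by (cases r) auto
  with \<open>2 * r + 4 \<le> 2 ^ r\<close> have "(r - 1) + 2 + 1 \<le> 2 ^ (r - 1)" using r by simp
  \<comment> \<open>At \<open>t = 0\<close>, level 2 provides
    \<open>2 * (r - j) = 2 + 2 * (r - 1 - j)\<close>, at least what level 1 asks for
    \<open>r - 1\<close> and \<open>t = 2\<close>.\<close>
  moreover have "level 1 n (r - 1) 2 L"
    unfolding level_def
  proof (intro allI impI)
    fix j assume j: "2 \<le> j" "j \<le> r - 1"
    then have "j \<le> r" by linarith
    with 0(4) j have "good n j (0 + 2 * (r - j)) L" unfolding level_def by blast
    then show "good n j (2 + 1 * (r - 1 - j)) L"
      by (rule good_mono) (use j r in linarith)
  qed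
  ultimately have "dens n L \<le> real (r - 1 + 2 + 1) / 2 ^ (r - 1 + 2)"
    using 0(3) by (intro ball_boundD ball) auto
  also have "r - 1 + 2 + 1 = r + 2" using r by simp
  also have "r - 1 + 2 = r + 1" using r by simp
  finally have "dens n L \<le> (real r + 2) / 2 ^ (r + 1)" by (simp add: add.commute)
  then have "2 ^ r * dens n L \<le> (real r + 2) / 2" by (simp add: field_simps)
  then show ?case using T' by simp
next
  case (Suc t)
  show ?case
  proof (cases n)
    case 0
    have "good n r (Suc t) L" using Suc.prems(4) r by (intro level_good) auto
    then have "L = {}" using 0 by (intro good_0_empty[of r "Suc t"]) auto
    then show ?thesis by simp
  next
    case (Suc m)
    have LC: "L \<subseteq> cube (Suc m)" and lev: "level 2 (Suc m) r (Suc t) L" using Suc.prems Suc by auto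
    have g: "good (Suc m) r (Suc t) L" using lev r by (intro level_good) auto
    have "level 2 m r t (trace [True] L)" using level_trace_True[OF lev] by simp
    then have 1: "2 ^ (r + t) * dens m (trace [True] L)
        \<le> (real r + 2) / 2 + real t + real (t + r - 1 - T) / 2"
      using Suc.prems Suc trace_cube_Suc[OF LC] by (intro Suc.IH) auto
    have g0: "good m r (t + r) (trace [False] L)" using good_trace_False[OF g] by simp
    have C0: "trace [False] L \<subseteq> cube m" by (rule trace_cube_Suc[OF LC])
    have T1: "r + T + 1 \<le> 2 ^ r" "1 \<le> T"
      using two_mult_add_four_le_power[OF r] T r by linarith+
    have 0: "2 ^ (r + t) * dens m (trace [False] L) \<le> 1 + (if T < t + r then 1 / 2 else 0)"
    proof (cases "T < t + r")
      case False
      then have "dens m (trace [False] L) \<le> 1 / 2 ^ (t + r)"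
        using Suc.prems(2)[of m] Suc g0 C0 T1 unfolding trivial_bound_def by auto
      then have "2 ^ (t + r) * dens m (trace [False] L) \<le> 2 ^ (t + r) * (1 / 2 ^ (t + r))"
        by (intro mult_left_mono) auto
      then show ?thesis using False by (simp add: add.commute[of r t])
    next
      case True
      define \<beta> :: real where "\<beta> = 1 / 2 + 1 / 2 ^ r"
      define u where "u = t + r - T"
      have u: "T + u = t + r" "u \<le> r - 1" using True Suc.prems(1) by (auto simp: u_def)
      have \<beta>: "0 < \<beta>" "1 + \<beta> ^ r \<le> 2 * \<beta>" "(2 * \<beta>) ^ (r - 1) \<le> 3 / 2"
        using geometric_rate[of r \<beta>] r by (auto simp: \<beta>_def add_pos_pos)
      have "dens m (trace [False] L) \<le> \<beta> ^ u / 2 ^ T"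
        using Suc.prems(2) Suc g0 u by (intro geometric_bound[OF _ T1(2,1) \<beta>(1,2) C0]) auto
      then have "2 ^ (T + u) * dens m (trace [False] L) \<le> 2 ^ (T + u) * (\<beta> ^ u / 2 ^ T)"
        by (intro mult_left_mono) auto
      also have "\<dots> = (2 * \<beta>) ^ u" by (simp add: power_add power_mult_distrib)
      also have "\<dots> \<le> (2 * \<beta>) ^ (r - 1)" using u by (intro power_increasing) (auto simp: \<beta>_def)
      finally show ?thesis using \<beta>(3) True unfolding u(1) by (simp add: add.commute[of r t])
    qed
    have "2 ^ (r + Suc t) * dens n L
        = 2 ^ (r + t) * dens m (trace [True] L) + 2 ^ (r + t) * dens m (trace [False] L)"
      using dens_Suc[OF LC] Suc by (simp add: distrib_left[symmetric])
    also have "\<dots> \<le> ((real r + 2) / 2 + real t + real (t + r - 1 - T) / 2)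
        + (1 + (if T < t + r then 1 / 2 else 0))"
      using 1 0 by (rule add_mono)
    also have "\<dots> = (real r + 2) / 2 + real (Suc t) + real (Suc t + r - 1 - T) / 2"
    proof (cases "T < t + r")
      case True
      then have "Suc t + r - 1 - T = Suc (t + r - 1 - T)" by simp
      then have "real (Suc t + r - 1 - T) = real (t + r - 1 - T) + 1" by (simp only: of_nat_Suc)
      then show ?thesis using True unfolding of_nat_Suc by (simp only: if_True) argo
    qed simp
    finally show ?thesis .
  qed
qed

section \<open>The case r = 3: traces after a prefix and one further hit\<close>

lemma trace_snoc_good:
  assumes n: "n = t + Suc m" and L: "good n 3 t L" and p: "p \<in> cube t" "0 < misses t p"
  shows "good m 3 (3 * misses t p - 1) (trace (p @ [True]) L)"
proof (rule good_trace[where t = t])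
  have len: "length p = t" using p by (simp add: cube_def)
  show "good (length (p @ [True]) + m) 3 t L" using L n len by simp
  show "k < 3 * misses k (p @ [True]) + t" if "k < length (p @ [True])" for k
    using that len p(2) by (cases "k = t") (auto simp: misses_append_le)
  show "3 * misses t p - 1 + length (p @ [True])
      \<le> 3 * misses (length (p @ [True])) (p @ [True]) + t"
    using len p(2) misses_append[of p 1 "[True]"] by simp
qed

text \<open>The miss of \<open>p\<close> counts three times for triples but only twice for pairs, so
  the surplus of pairs over triples drops from \<open>Suc k\<close> to \<open>k\<close>.\<close>

lemma trace_snoc_level:
  assumes n: "n = t + Suc m" and L: "level (Suc k) n 3 t L"
    and p: "p \<in> cube t" "misses t p = 1" and t: "1 \<le> t"
  shows "level k m 3 2 (trace (p @ [True]) L)"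
  unfolding level_def
proof (intro allI impI)
  fix j :: nat assume j: "2 \<le> j" "j \<le> 3"
  have len: "length p = t" using p by (simp add: cube_def)
  have "j = 2 \<or> j = 3" using j by auto
  then show "good m j (2 + k * (3 - j)) (trace (p @ [True]) L)"
  proof
    assume "j = 3"
    then show ?thesis
      using trace_snoc_good[OF n level_good[OF L] p(1)] p(2) by simp
  next
    assume j: "j = 2"
    have g: "good n 2 (t + Suc k) L" using L unfolding level_def by fastforce
    have "good m 2 (2 + k) (trace (p @ [True]) L)"
    proof (rule good_trace[where t = "t + Suc k"])
      show "good (length (p @ [True]) + m) 2 (t + Suc k) L" using g n len by simp
      show "i < 2 * misses i (p @ [True]) + (t + Suc k)" if "i < length (p @ [True])" for i
        using that len by simp
      show "2 + k + length (p @ [True])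
          \<le> 2 * misses (length (p @ [True])) (p @ [True]) + (t + Suc k)"
        using len p(2) misses_append[of p 1 "[True]"] by simp
    qed
    with j show ?thesis by simp
  qed
qed

text \<open>Trace bounds sorted by the number of misses of the prefix. The full prefix gets 0
  because \<open>prefix_bound\<close> accounts for it separately.\<close>

definition weight :: "real \<Rightarrow> real \<Rightarrow> (nat \<Rightarrow> real) \<Rightarrow> nat \<Rightarrow> real" where
  "weight c d w i = (if i = 0 then 0 else if i = 1 then c else if i = 2 then d else w i)"

lemma weighted_prefix_bound:
  assumes L: "dominance_closed n L" "level 2 n 3 t L" and t: "1 \<le> t"
    and c: "\<And>m p. n = t + Suc m \<Longrightarrow> p \<in> cube t \<Longrightarrow> misses t p = 1 \<Longrightarrow> dens m (trace (p @ [True]) L) \<le> c"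
    and d: "\<And>m p. n = t + Suc m \<Longrightarrow> p \<in> cube t \<Longrightarrow> misses t p = 2 \<Longrightarrow> dens m (trace (p @ [True]) L) \<le> d"
    and w: "\<And>m p. n = t + Suc m \<Longrightarrow> p \<in> cube t \<Longrightarrow> 3 \<le> misses t p \<Longrightarrow>
      dens m (trace (p @ [True]) L) \<le> w (misses t p)"
    and S: "(\<Sum>p\<in>cube t. weight c d w (misses t p)) \<le> S" "S \<le> 1" "0 \<le> S"
  shows "2 ^ t * dens n L \<le> (1 + S) / 2"
proof (cases "L = {}")
  case True
  then show ?thesis using S by simp
next
  case False
  have g2: "good n 2 (t + 2) L" using L(2) unfolding level_def by fastforce
  then have "t + 2 \<le> n" using False by (rule good_nonempty)
  then obtain m where n: "n = t + Suc m" by (metis Suc_leD add_2_eq_Suc' le_Suc_ex add_Suc_right add.commute add_Suc_shift)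
  show ?thesis
    unfolding n
  proof (rule prefix_bound[where b = "weight c d w"])
    show "dominance_closed (t + Suc m) L" "good (t + Suc m) 3 t L" "good (t + Suc m) 2 (t + 1) L"
      using L n level_good[of 2 n 3 t L] good_mono[OF g2, of "t + 1"] by auto
    show "dens m (trace (p @ [True]) L) \<le> weight c d w (misses t p)"
      if "p \<in> cube t" "0 < misses t p" for p
      using that c[OF n] d[OF n] w[OF n] by (auto simp: weight_def)
  qed (use S in \<open>auto simp: weight_def\<close>)
qed

lemma closed_level_2_bound:
  assumes "L \<subseteq> cube n" "level 2 n 3 t L"
    and "\<And>L. dominance_closed n L \<Longrightarrow> level 2 n 3 t L \<Longrightarrow> dens n L \<le> B"
  shows "dens n L \<le> B"
proof -
  have "dens n L \<le> dens n (dominance_closure n L)"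
    using assms(1) by (intro dens_mono subset_dominance_closure) (auto simp: dominance_closure_def)
  also have "\<dots> \<le> B"
    using assms by (intro assms(3) dominance_closed_closure level_dominance_closure)
  finally show ?thesis .
qed

text \<open>A trace with \<open>i\<close> misses has level \<open>3 * i - 1 = 4 + (3 * i - 5)\<close> after one further hit, so this is
  \<open>geometric_bound\<close> for \<open>T = 4\<close> with the rate \<open>1 / 2 + 1 / 2^3\<close>.\<close>

definition tail_weight :: "nat \<Rightarrow> real" where
  "tail_weight i = (5 / 8) ^ (3 * i - 5) / 16"

context
  fixes n :: nat
  assumes ball: "\<And>m. m < n \<Longrightarrow> ball_bound 3 m"
begin

lemma trivial_bound_3: "m < n \<Longrightarrow> trivial_bound 3 m"
  using ball by (intro trivial_bound_if_ball_bound) auto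

lemma trace_snoc_tail:
  assumes n: "n = t + Suc m" and L: "L \<subseteq> cube n" "good n 3 t L"
    and p: "p \<in> cube t" "2 \<le> misses t p"
  shows "dens m (trace (p @ [True]) L) \<le> tail_weight (misses t p)"
proof -
  have len: "length p = t" using p by (simp add: cube_def)
  have C: "trace (p @ [True]) L \<subseteq> cube m" using L n len by (intro trace_cube) simp
  have "good m 3 (4 + (3 * misses t p - 5)) (trace (p @ [True]) L)"
    using trace_snoc_good[OF n L(2) p(1)] p(2) by (simp add: algebra_simps)
  then have "dens m (trace (p @ [True]) L) \<le> (5 / 8) ^ (3 * misses t p - 5) / 2 ^ 4"
    using trivial_bound_3 n by (intro geometric_bound[OF _ _ _ _ _ C]) (auto simp: eval_nat_numeral)
  then show ?thesis by (simp add: tail_weight_def)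
qed

text \<open>\<open>3 / 16\<close> is the ball bound \<open>6 / 2 ^ 5\<close> for
  \<open>t = 2\<close>; the trace still has level 1.\<close>

lemma trace_snoc_single:
  assumes n: "n = t + Suc m" and L: "L \<subseteq> cube n" "level 2 n 3 t L"
    and p: "p \<in> cube t" "misses t p = 1" and t: "1 \<le> t"
  shows "dens m (trace (p @ [True]) L) \<le> 3 / 16"
proof -
  have "length p = t" using p by (simp add: cube_def)
  then have "trace (p @ [True]) L \<subseteq> cube m" using L n by (intro trace_cube) simp
  moreover have "level 1 m 3 2 (trace (p @ [True]) L)"
    using trace_snoc_level[of n t m 1 L p] n L p t by (simp add: numeral_2_eq_2)
  ultimately have "dens m (trace (p @ [True]) L) \<le> real (3 + 2 + 1) / 2 ^ (3 + 2)"
    using n by (intro ball_boundD ball) auto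
  then show ?thesis by simp
qed

text \<open>The prefixes with a miss contribute \<open>2 * 3 / 16 + 5 / 128 = 53 / 128\<close>. The
  gain over \<open>3 / 16 = 192 / 1024\<close> serves the case \<open>t = 4\<close>.\<close>

lemma level_2_3_2:
  assumes "L \<subseteq> cube n" "level 2 n 3 2 L"
  shows "dens n L \<le> 181 / 1024"
  using assms
proof (rule closed_level_2_bound)
  fix L assume L: "dominance_closed n L" "level 2 n 3 2 L"
  then have C: "L \<subseteq> cube n" by (simp add: dominance_closed_def)
  have "2 ^ 2 * dens n L \<le> (1 + 53 / 128) / 2"
  proof (rule weighted_prefix_bound[OF L, where c = "3 / 16" and d = "5 / 128" and w = tail_weight])
    show "dens m (trace (p @ [True]) L) \<le> 3 / 16" if "n = 2 + Suc m" "p \<in> cube 2" "misses 2 p = 1" for m p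
      using that C L by (intro trace_snoc_single) auto
    show "dens m (trace (p @ [True]) L) \<le> 5 / 128" if "n = 2 + Suc m" "p \<in> cube 2" "misses 2 p = 2" for m p
      using that trace_snoc_tail[OF _ C level_good[OF L(2)], of m p] by (simp add: tail_weight_def)
    show "dens m (trace (p @ [True]) L) \<le> tail_weight (misses 2 p)"
      if "n = 2 + Suc m" "p \<in> cube 2" "3 \<le> misses 2 p" for m p
      using that trace_snoc_tail[OF _ C level_good[OF L(2)], of m p] by simp
    show "(\<Sum>p\<in>cube 2. weight (3 / 16) (5 / 128) tail_weight (misses 2 p)) \<le> 53 / 128"
      by (simp add: numeral_2_eq_2 sum_cube_Suc weight_def)
  qed auto
  then show "dens n L \<le> 181 / 1024" by simp
qed

lemma level_2_3_3:
  assumes "L \<subseteq> cube n" "level 2 n 3 3 L"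
  shows "dens n L \<le> 7 / 64"
  using assms
proof (rule closed_level_2_bound)
  fix L assume L: "dominance_closed n L" "level 2 n 3 3 L"
  then have C: "L \<subseteq> cube n" by (simp add: dominance_closed_def)
  \<comment> \<open>A total weight of \<open>3 / 4\<close> is exactly what leads to the ball bound
    \<open>7 / 2 ^ 6\<close>.\<close>
  have "2 ^ 3 * dens n L \<le> (1 + 3 / 4) / 2"
  proof (rule weighted_prefix_bound[OF L, where c = "3 / 16" and d = "5 / 128" and w = tail_weight])
    show "dens m (trace (p @ [True]) L) \<le> 3 / 16" if "n = 3 + Suc m" "p \<in> cube 3" "misses 3 p = 1" for m p
      using that C L by (intro trace_snoc_single) auto
    show "dens m (trace (p @ [True]) L) \<le> 5 / 128" if "n = 3 + Suc m" "p \<in> cube 3" "misses 3 p = 2" for m p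
      using that trace_snoc_tail[OF _ C level_good[OF L(2)], of m p] by (simp add: tail_weight_def)
    show "dens m (trace (p @ [True]) L) \<le> tail_weight (misses 3 p)"
      if "n = 3 + Suc m" "p \<in> cube 3" "3 \<le> misses 3 p" for m p
      using that trace_snoc_tail[OF _ C level_good[OF L(2)], of m p] by simp
    show "(\<Sum>p\<in>cube 3. weight (3 / 16) (5 / 128) tail_weight (misses 3 p)) \<le> 3 / 4"
      by (simp add: numeral_3_eq_3 sum_cube_Suc weight_def tail_weight_def eval_nat_numeral)
  qed auto
  then show "dens n L \<le> 7 / 64" by simp
qed

end

text \<open>The ball bound \<open>8 / 2 ^ 7\<close> requires total weight at most 1, which the
  weights of the case \<open>t = 3\<close> slightly exceed. A member with two misses among the first
  four coordinates and three among the first six yields level 3 and improves \<open>3 / 16\<close>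
  to \<open>181 / 1024\<close>. Without such a member, prefixes with two or more misses weigh
  less.\<close>

lemma level_2_3_4:
  assumes ball: "\<And>m. m < n \<Longrightarrow> ball_bound 3 m"
    and "L \<subseteq> cube n" "level 2 n 3 4 L"
  shows "dens n L \<le> 1 / 16"
  using assms(2,3)
proof (rule closed_level_2_bound)
  fix L assume L: "dominance_closed n L" "level 2 n 3 4 L"
  then have C: "L \<subseteq> cube n" by (simp add: dominance_closed_def)
  have g: "good n 3 4 L" using L(2) by (rule level_good) simp
  have len: "length p = 4" if "p \<in> cube 4" for p using that by (simp add: cube_def)
  have cube_4: "cube 4 = cube (Suc (Suc (Suc (Suc 0))))" by (simp add: eval_nat_numeral)
  have "2 ^ 4 * dens n L \<le> (1 + 1) / 2"
  proof (cases "\<exists>A\<in>L. 2 \<le> misses 4 A \<and> 3 \<le> misses 6 A")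
    case True
    then obtain A where A: "A \<in> L" "2 \<le> misses 4 A" "3 \<le> misses 6 A" by blast
    have lev: "level 3 n 3 4 L"
    proof (rule level_witness[OF g A(1)])
      fix m
      show "3 \<le> misses m A \<or> m < 4 + misses m A"
        using A(2,3) misses_mono[of 4 m A] misses_mono[of 6 m A]
        by (cases "m < 4"; cases "m < 6") auto
    qed
    show ?thesis
    proof (rule weighted_prefix_bound[OF L, where c = "181 / 1024" and d = "5 / 128" and w = tail_weight])
      show "dens m (trace (p @ [True]) L) \<le> 181 / 1024"
        if "n = 4 + Suc m" "p \<in> cube 4" "misses 4 p = 1" for m p
      proof -
        have "level 2 m 3 2 (trace (p @ [True]) L)"
          using trace_snoc_level[of n 4 m 2 L p] that lev by (simp add: numeral_3_eq_3 numeral_2_eq_2)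
        moreover have "trace (p @ [True]) L \<subseteq> cube m" using C that len by (intro trace_cube) simp
        ultimately show ?thesis using that(1) by (intro level_2_3_2 ball) auto
      qed
      show "dens m (trace (p @ [True]) L) \<le> 5 / 128" if "n = 4 + Suc m" "p \<in> cube 4" "misses 4 p = 2" for m p
        using that trace_snoc_tail[OF ball _ C g, of m p] by (simp add: tail_weight_def)
      show "dens m (trace (p @ [True]) L) \<le> tail_weight (misses 4 p)"
        if "n = 4 + Suc m" "p \<in> cube 4" "3 \<le> misses 4 p" for m p
        using that trace_snoc_tail[OF ball _ C g, of m p] by simp
      show "(\<Sum>p\<in>cube 4. weight (181 / 1024) (5 / 128) tail_weight (misses 4 p)) \<le> 1"
        by (simp add: eval_nat_numeral sum_cube_Suc weight_def tail_weight_def)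
    qed auto
  next
    case False
    then have few: "misses 6 A \<le> 2" if "A \<in> L" "2 \<le> misses 4 A" for A
      using that False by (cases "3 \<le> misses 6 A") auto
    show ?thesis
    proof (rule weighted_prefix_bound[OF L, where c = "3 / 16" and d = "1 / 32" and w = "\<lambda>_. 0"])
      show "dens m (trace (p @ [True]) L) \<le> 3 / 16" if "n = 4 + Suc m" "p \<in> cube 4" "misses 4 p = 1" for m p
        using that C L by (intro trace_snoc_single[OF ball]) auto
      \<comment> \<open>After the two misses of \<open>p\<close> the next two coordinates must be
        hits, which leaves level \<open>3 * 2 + 4 - 6 = 4\<close>; the second of these hits accounts
        for a factor 1/2.\<close>
      show "dens m (trace (p @ [True]) L) \<le> 1 / 32"
        if n: "n = 4 + Suc m" and p: "p \<in> cube 4" "misses 4 p = 2" for m p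
      proof (cases m)
        case 0
        \<comment> \<open>There are only five coordinates here, too few for level 6.\<close>
        have "good n 2 6 L" using L(2) unfolding level_def by fastforce
        then have "L = {}" using good_nonempty[of n 2 6 L] n 0 by force
        then show ?thesis by (simp add: trace_def)
      next
        case (Suc k)
        let ?q = "p @ [True]"
        have qC: "trace ?q L \<subseteq> cube (Suc k)" using C n len p Suc by (intro trace_cube) simp
        have "trace [False] (trace ?q L) = {}"
        proof (rule ccontr)
          assume "trace [False] (trace ?q L) \<noteq> {}"
          then obtain x where x: "p @ [True, False] @ x \<in> L" by (auto simp: trace_def)
          have "misses (4 + 2) (p @ [True, False] @ x) = misses 4 p + misses 2 ([True, False] @ x)"
            using misses_append[of p 2 "[True, False] @ x"] len p by simp
          moreover have "misses 4 (p @ [True, False] @ x) = misses 4 p"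
            using misses_append_le[of 4 p] len p by simp
          ultimately show False using few[OF x] p by (simp add: numeral_2_eq_2)
        qed
        moreover have "dens k (trace [True] (trace ?q L)) \<le> 1 / 2 ^ 4"
        proof (rule trivial_boundD)
          show "trivial_bound 3 k" using ball n Suc by (intro trivial_bound_3[of n]) auto
          show "trace [True] (trace ?q L) \<subseteq> cube k" using trace_cube_Suc[OF qC] .
          show "good k 3 4 (trace [True] (trace ?q L))"
            unfolding trace_trace
          proof (rule good_trace[where t = 4])
            show "good (length (?q @ [True]) + k) 3 4 L" using g n Suc len p by simp
            show "i < 3 * misses i (?q @ [True]) + 4" if "i < length (?q @ [True])" for i
            proof (cases "i < 4")
              case False
              then have "misses 4 (?q @ [True]) \<le> misses i (?q @ [True])" by (intro misses_mono) simp
              moreover have "misses 4 (?q @ [True]) = 2" using misses_append_le[of 4 p] len p by simp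
              ultimately show ?thesis using that len p by simp
            qed simp
            have "misses (4 + 2) (p @ [True, True]) = misses 4 p + misses 2 [True, True]"
              using misses_append[of p 2 "[True, True]"] len p by simp
            then show "4 + length (?q @ [True]) \<le> 3 * misses (length (?q @ [True])) (?q @ [True]) + 4"
              using len p by (simp add: numeral_2_eq_2)
          qed
        qed simp
        ultimately show ?thesis
          using dens_Suc_le[OF qC, of 4] Suc by simp
      qed
      show "dens m (trace (p @ [True]) L) \<le> 0" if "n = 4 + Suc m" "p \<in> cube 4" "3 \<le> misses 4 p" for m p
      proof -
        have "trace (p @ [True]) L = {}"
        proof (rule ccontr)
          assume "trace (p @ [True]) L \<noteq> {}"
          then obtain x where x: "p @ [True] @ x \<in> L" by (auto simp: trace_def)
          have "misses 4 (p @ [True] @ x) = misses 4 p"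
            using misses_append_le[of 4 p] len that by simp
          then show False using few[OF x] that misses_mono[of 4 6 "p @ [True] @ x"] by simp
        qed
        then show ?thesis by simp
      qed
      show "(\<Sum>p\<in>cube 4. weight (3 / 16) (1 / 32) (\<lambda>_. 0) (misses 4 p)) \<le> 1"
        by (simp add: eval_nat_numeral sum_cube_Suc weight_def)
    qed auto
  qed
  then show "dens n L \<le> 1 / 16" by simp
qed

section \<open>The main induction\<close>

lemma ball_bound_2: "ball_bound 2 n"
  unfolding ball_bound_def
proof (intro allI impI)
  fix t L assume L: "L \<subseteq> cube n" "2 + t + 1 \<le> (2::nat) ^ 2" "1 \<le> t \<or> 3 \<le> (2::nat)" "level 1 n 2 t L"
  then have t: "t = 1" by simp
  then have "good n 2 1 L" using level_good[OF L(4)] by simp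
  then have "dens n L \<le> 1 / 2" using L(1) by (rule dens_good_2_1)
  with t show "dens n L \<le> real (2 + t + 1) / 2 ^ (2 + t)" by (simp add: eval_nat_numeral)
qed

lemma linear_le_power:
  assumes "3 \<le> r"
  shows "r + 1 \<le> (2 :: nat) ^ (r - 1)" "2 * r \<le> 2 ^ r"
proof -
  have "k + 2 \<le> (2 :: nat) ^ k" if "2 \<le> k" for k
    using that by (induction k rule: dec_induct) auto
  from this[of "r - 1"] show *: "r + 1 \<le> (2 :: nat) ^ (r - 1)" using assms by simp
  have "(2 :: nat) ^ r = 2 * 2 ^ (r - 1)" using assms by (cases r) auto
  with * show "2 * r \<le> 2 ^ r" by simp
qed

text \<open>For \<open>r = 3\<close> only \<open>t = 3\<close> and \<open>t = 4\<close> are in the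
  range. For \<open>r \<ge> 4\<close>, \<open>level_2_bound\<close> gives at most
  \<open>(r + 2) / 2 + t + (r - 1) / 2\<close>, which is below \<open>r + t + 1\<close>.\<close>

lemma level_2_ball_bound:
  assumes r: "3 \<le> r" and prev: "\<And>m. ball_bound (r - 1) m" and ball: "\<And>m. m < n \<Longrightarrow> ball_bound r m"
    and t: "r + t + 1 \<le> 2 ^ r" "2 ^ r < t + 2 * r" and L: "L \<subseteq> cube n" "level 2 n r t L"
  shows "dens n L \<le> real (r + t + 1) / 2 ^ (r + t)"
proof (cases "r = 3")
  case True
  then consider "t = 3" | "t = 4" using t by fastforce
  then show ?thesis
  proof cases
    case 1
    then show ?thesis using level_2_3_3[of n L] ball L True by (simp add: eval_nat_numeral)
  next
    case 2
    then show ?thesis using level_2_3_4[of n L] ball L True by (simp add: eval_nat_numeral)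
  qed
next
  case False
  define T where "T = 2 ^ r - r - 1"
  have "trivial_bound r m" if "m < n" for m
    using ball that by (intro trivial_bound_if_ball_bound) auto
  then have "2 ^ (r + t) * dens n L \<le> (real r + 2) / 2 + real t + real (t + r - 1 - T) / 2"
    using r False t by (intro level_2_bound[OF _ prev _ T_def _ L]) (auto simp: T_def)
  also have "real (t + r - 1 - T) \<le> real r - 1"
  proof -
    have "t + r - 1 - T \<le> r - 1" using t by (simp add: T_def)
    then have "real (t + r - 1 - T) \<le> real (r - 1)" by (rule of_nat_mono)
    then show ?thesis using r by (simp add: of_nat_diff)
  qed
  finally have "2 ^ (r + t) * dens n L \<le> real (r + t + 1)" by (simp add: field_simps)
  then show ?thesis by (simp add: field_simps)
qed

lemma ball_bound_step:
  assumes r: "3 \<le> r" and prev: "\<And>n. ball_bound (r - 1) n"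
  shows "ball_bound r n"
proof (induction n rule: less_induct)
  case (less n)
  have triv: "trivial_bound r m" if "m < n" for m
    using less that by (intro trivial_bound_if_ball_bound) auto
  show ?case
    unfolding ball_bound_def
  proof (intro allI impI)
    fix t L assume L: "L \<subseteq> cube n" and t: "r + t + 1 \<le> 2 ^ r" and lev: "level 1 n r t L"
    show "dens n L \<le> real (r + t + 1) / 2 ^ (r + t)"
    proof (cases "t = 0")
      case True
      have "level 1 n (r - 1) 1 L"
        unfolding level_def
      proof (intro allI impI)
        fix j assume j: "2 \<le> j" "j \<le> r - 1"
        then have "good n j (0 + 1 * (r - j)) L" using lev True by (auto simp: level_def)
        moreover have "0 + 1 * (r - j) = 1 + 1 * (r - 1 - j)" using j r by simp
        ultimately show "good n j (1 + 1 * (r - 1 - j)) L" by simp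
      qed
      then have "dens n L \<le> real (r - 1 + 1 + 1) / 2 ^ (r - 1 + 1)"
        using L r linear_le_power[OF r] by (intro ball_boundD[OF prev]) auto
      then show ?thesis using r True by (simp add: of_nat_diff)
    next
      case False
      then have t1: "1 \<le> t" by simp
      have g: "good n r t L" using lev r by (intro level_good) auto
      show ?thesis
      proof (cases n)
        case 0
        then show ?thesis using good_0_empty[of r t L] g t1 by simp
      next
        case (Suc m)
        have LC: "L \<subseteq> cube (Suc m)" using L Suc by simp
        have gS: "good (Suc m) r t L" using g Suc by simp
        have C: "trace [b] L \<subseteq> cube m" for b using trace_cube_Suc[OF LC] .
        have g0: "good m r (t + r - 1) (trace [False] L)" by (rule good_trace_False[OF gS t1])
        \<comment> \<open>Half the sum of \<open>(r + t) / 2 ^ (r + t - 1)\<close> and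
          \<open>1 / 2 ^ (r + t - 1)\<close> is exactly the ball bound.\<close>
        have combine: ?thesis if 0: "dens m (trace [False] L) \<le> 1 / 2 ^ (t + r - 1)"
        proof -
          obtain k where k: "t = Suc k" using t1 by (cases t) auto
          have "level 1 (Suc m) r t L" using lev Suc by simp
          then have "level 1 m r k (trace [True] L)" using level_trace_True[OF _ t1] k by fastforce
          then have 1: "dens m (trace [True] L) \<le> real (r + k + 1) / 2 ^ (r + k)"
            using Suc C t k r by (intro ball_boundD less) auto
          have "dens n L \<le> (real (r + k + 1) / 2 ^ (r + k) + 1 / 2 ^ (r + k)) / 2"
            using dens_Suc[OF LC] Suc 0 1 k by (simp add: add.commute)
          also have "\<dots> = real (r + t + 1) / 2 ^ (r + t)" using k by (simp add: field_simps)
          finally show ?thesis .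
        qed
        \<comment> \<open>\<open>small\<close> is the range condition of the trivial bound at level
          \<open>t + r - 1\<close>.\<close>
        consider (small) "t + 2 * r \<le> 2 ^ r"
          | (hits) "\<And>A. A \<in> trace [False] L \<Longrightarrow> misses t A = 0"
          | (level2) A where "2 ^ r < t + 2 * r" "A \<in> trace [False] L" "1 \<le> misses t A"
          by (meson leI less_one)
        then show ?thesis
        proof cases
          case level2
          then have "level 2 (Suc m) r t L"
            by (intro level_2_witness[OF gS _ t1]) (auto simp: trace_def)
          then show ?thesis
            using level2(1) Suc t L by (intro level_2_ball_bound[OF r prev less]) auto
        next
          case small
          have "dens m (trace [False] L) \<le> 1 / 2 ^ (t + r - 1)"
            using small t1 Suc by (intro trivial_boundD[OF triv C g0]) auto
          then show ?thesis by (rule combine)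
        next
          case hits
          \<comment> \<open>Once the \<open>t\<close> hits are peeled off, level
            \<open>r - 1\<close> remains, whose range condition is
            \<open>2 * r \<le> 2 ^ r\<close>.\<close>
          have "dens m (trace [False] L) \<le> 1 / 2 ^ (t + (r - 1))"
            using hits Suc g0 C r linear_le_power[OF r] by (intro prefix_trivial_bound[OF triv]) auto
          then show ?thesis using r by (intro combine) simp
        qed
      qed
    qed
  qed
qed

lemma ball_bound_all: "2 \<le> r \<Longrightarrow> ball_bound r n"
proof (induction r arbitrary: n rule: dec_induct)
  case base
  show ?case by (rule ball_bound_2)
next
  case (step r)
  have "3 \<le> Suc r" using step(1) by simp
  moreover have "ball_bound (Suc r - 1) m" for m using step(3) by simp
  ultimately show ?case by (rule ball_bound_step)
qed

section \<open>Translation of sets into words\<close>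

definition encode :: "nat \<Rightarrow> nat set \<Rightarrow> bool list" where
  "encode n A = map (\<lambda>i. i \<in> A) [1..<Suc n]"

lemma misses_encode:
  assumes "m \<le> n"
  shows "misses m (encode n A) = card ({1..m} - A)"
proof -
  have "take m [1..<Suc n] = [1..<Suc m]" using assms by (simp add: take_upt del: upt_Suc)
  then have "misses m (encode n A) = length (filter (\<lambda>i. i \<notin> A) [1..<Suc m])"
    by (simp add: misses_def encode_def take_map filter_map o_def del: upt_Suc)
  also have "\<dots> = card (set (filter (\<lambda>i. i \<notin> A) [1..<Suc m]))"
    by (rule distinct_card[symmetric]) simp
  also have "set (filter (\<lambda>i. i \<notin> A) [1..<Suc m]) = {1..m} - A" by auto
  finally show ?thesis .
qed

lemma inj_on_encode: "inj_on (encode n) (Pow {1..n})"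
proof (rule inj_onI)
  fix A B assume AB: "A \<in> Pow {1..n}" "B \<in> Pow {1..n}" "encode n A = encode n B"
  then have "i \<in> A \<longleftrightarrow> i \<in> B" if "i \<in> {1..n}" for i
    using that by (auto simp: encode_def simp del: upt_Suc)
  with AB show "A = B" by blast
qed

theorem theorem1:
  fixes n r t :: nat and F :: "nat set set"
  assumes "n > r" and "r \<ge> 2" and "1 \<le> t" and "t \<le> 2 ^ r - r - 1"
    and "F \<subseteq> Pow {1..n}"
    and "nontrivial_family n F"
    and "r_wise_t_agreeing n r t F"
  shows "real (card F) \<le> real (r + t + 1) * (2::real) powi (int n - int r - int t)"
proof -
  obtain F' where F': "F' \<subseteq> Pow {1..n}" "card F' = card F"
    and int: "\<And>j. 2 \<le> j \<Longrightarrow> j \<le> r \<Longrightarrow> intersecting n j (t + r - j) F'"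
    and up: "\<And>x A. x \<in> {1..n} \<Longrightarrow> A \<in> F' \<Longrightarrow> insert x A \<in> F'"
    and sw: "\<And>x y A. x \<in> {1..n} \<Longrightarrow> y \<in> {1..n} \<Longrightarrow> x < y \<Longrightarrow> A \<in> F' \<Longrightarrow> swap_to x y A \<in> F'"
    using exists_shifted_intersecting_family[OF assms(6,7,5,3)] by blast
  define L where "L = encode n ` F'"
  have LC: "L \<subseteq> cube n" by (auto simp: L_def cube_def encode_def simp del: upt_Suc)
  have card: "card L = card F"
    unfolding L_def using F' inj_on_subset[OF inj_on_encode F'(1)] by (simp add: card_image)
  have "good n j (t + 1 * (r - j)) L" if j: "2 \<le> j" "j \<le> r" for j
    unfolding good_def
  proof (intro allI impI)
    fix As :: "bool list list" assume As: "length As = j" "set As \<subseteq> L"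
    then have "\<forall>i<j. \<exists>A\<in>F'. As ! i = encode n A" by (force simp: L_def)
    then obtain G where G: "\<And>i. i < j \<Longrightarrow> G i \<in> F'" "\<And>i. i < j \<Longrightarrow> As ! i = encode n (G i)" by metis
    have "\<exists>m\<le>n. (\<Sum>i<j. card ({1..m} - G i)) + (t + r - j) \<le> m"
    proof (rule dominance_closed_intersecting[OF _ int[OF j]])
      show "B \<in> F'" if "A \<in> F'" "B \<subseteq> {1..n}"
        "\<And>m. m \<le> n \<Longrightarrow> card ({1..m} - B) \<le> card ({1..m} - A)" for A B
        using that F' up sw by (intro shifted_closed_under_dominance[of n F' A B]) auto
    qed (rule G)
    then obtain m where m: "m \<le> n" "(\<Sum>i<j. card ({1..m} - G i)) + (t + r - j) \<le> m" by blast
    have "(\<Sum>A\<leftarrow>As. misses m A) = (\<Sum>i<j. misses m (As ! i))"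
      using As by (simp add: sum_list_sum_nth atLeast0LessThan)
    also have "\<dots> = (\<Sum>i<j. card ({1..m} - G i))"
      using G m by (intro sum.cong) (auto simp: misses_encode)
    finally show "\<exists>m\<le>n. (\<Sum>A\<leftarrow>As. misses m A) + (t + 1 * (r - j)) \<le> m"
      using m j by (intro exI[of _ m]) simp
  qed
  then have "level 1 n r t L" by (simp add: level_def)
  \<comment> \<open>The subtraction of natural numbers does not truncate, since
    \<open>1 \<le> t\<close>.\<close>
  moreover have "r + t + 1 \<le> 2 ^ r" using assms(3,4) by linarith
  ultimately have "dens n L \<le> real (r + t + 1) / 2 ^ (r + t)"
    using ball_bound_all[OF assms(2)] LC assms(3) by (intro ball_boundD) auto
  then have "real (card F) \<le> real (r + t + 1) * (2 ^ n / 2 ^ (r + t))"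
    by (simp add: dens_def card field_simps)
  also have "2 ^ n / 2 ^ (r + t) = (2::real) powi (int n - int r - int t)"
    by (simp add: power_int_diff power_add)
  finally show ?thesis .
qed

end
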